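(* Let $\mathcal{A}$ be stable and let $(\mathscr{W},\mathscr{S})\in\{(\mathscr{W}_{\mathrm{cor}},\mathscr{S}_{\mathrm{cor}}),(\mathscr{W}_{\mathrm{ind}},\mathscr{S}_{\mathrm{ind}})\}$. Consider the following two problems. Problem (II): maximize $\limsup_{T\to\infty}\frac1T\sum_{t=0}^{T-1}\mathbb{E}\|z(t)\|^2$ over pairs of processes $w,\hat w:\mathbb{N}_0\to L_2(\Omega,\mathbb{R}^{n_w})$, subject to $\chi(t+1)=\mathcal{A}\chi(t)+\mathcal{B}w(t)$, $z(t)=\mathcal{C}\chi(t)+\mathcal{D}w(t)$, $\mathbb{E}\|w(t)-\hat w(t)\|^2\le\gamma^2$, $\mathbb{P}_{\hat w(t)}=\mathbb{P}_{\mathrm{nom}}$ for all $t\in\mathbb{N}_0$, and $\chi(0)=0$; in the case $\mathscr{W}=\mathscr{W}_{\mathrm{ind}}$ it is additionally required that the random variables $w(t)$, $t\in\mathbb{N}_0$, are independent and have zero mean. Problem (III): maximize over $\Sigma\in\mathscr{S}$ the objective $\operatorname{tr}\left(\begin{pmatrix}\mathcal{C}&\mathcal{D}&0\end{pmatrix}\Sigma\begin{pmatrix}\mathcal{C}&\mathcal{D}&0\end{pmatrix}^\top\right)$ subject to $$\begin{pmatrix}I&0&0\end{pmatrix}\Sigma\begin{pmatrix}I&0&0\end{pmatrix}^\top=\begin{pmatrix}\mathcal{A}&\mathcal{B}&0\end{pmatrix}\Sigma\begin{pmatrix}\mathcal{A}&\mathcal{B}&0\end{pmatrix}^\top,$$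 $$\gamma^2\ge\operatorname{tr}\left(\begin{pmatrix}0&I&0\\0&0&I\end{pmatrix}\Sigma\begin{pmatrix}0&I&0\\0&0&I\end{pmatrix}^\top\begin{pmatrix}I&-I\\-I&I\end{pmatrix}\right),$$ $$\Sigma_{\mathrm{nom}}=\begin{pmatrix}0&0&I\end{pmatrix}\Sigma\begin{pmatrix}0&0&I\end{pmatrix}^\top,\qquad\Sigma\succeq0.$$ Then both problems are feasible and their optimal values (suprema) coincide.
   Context: Plant: $x(t+1)=Ax(t)+B_ww(t)+B_uu(t)$, $z(t)=C_zx(t)+D_{zw}w(t)+D_{zu}u(t)$, $y(t)=C_yx(t)+D_{yw}w(t)$, with real matrices of compatible dimensions, where $x(t)\in\mathbb{R}^{n_x}$, $w(t)\in\mathbb{R}^{n_w}$, $u(t)\in\mathbb{R}^{n_u}$, $z(t)\in\mathbb{R}^{n_z}$, $y(t)\in\mathbb{R}^{n_y}$. Controller (fixed): $x_c(t+1)=A_cx_c(t)+B_cy(t)$, $u(t)=C_cx_c(t)+D_cy(t)$, with $x_c(t)\in\mathbb{R}^{n_x}$. The closed-loop state is $\chi=(x^\top,x_c^\top)^\top\in\mathbb{R}^{2n_x}$ and the closed-loop matrices are $$\mathcal{A}=\begin{pmatrix}A+B_uD_cC_y&B_uC_c\\ B_cC_y&A_c\end{pmatrix},\quad \mathcal{B}=\begin{pmatrix}B_w+B_uD_cD_{yw}\\ B_cD_{yw}\end{pmatrix},\quad \mathcal{C}=\begin{pmatrix}C_z+D_{zu}D_cC_y&D_{zu}C_c\end{pmatrix},\quad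 \mathcal{D}=D_{zw}+D_{zu}D_cD_{yw}.$$ Stable means that all eigenvalues of $\mathcal{A}$ lie in the open unit disc. All stochastic processes in a candidate solution are defined on a common (separable, metric) probability space $\Omega$, which is not fixed in advance: suprema over stochastic processes are taken over all processes with the listed properties on any such space. $\mathbb{P}_v$ is the distribution of $v$, and $\mathbb{W}$ is the 2-Wasserstein metric. Let $\gamma\ge0$ and let $\mathbb{P}_{\mathrm{nom}}$ be a fixed zero-mean normal distribution on $\mathbb{R}^{n_w}$ with second moment $\Sigma_{\mathrm{nom}}$. $\mathscr{W}_{\mathrm{cor}}$ is the set of all sequences $w:\mathbb{N}_0\to L_2(\Omega,\mathbb{R}^{n_w})$ with $\mathbb{W}(\mathbb{P}_{w(t)},\mathbb{P}_{\mathrm{nom}})\le\gamma$ for all $t$; $\mathscr{W}_{\mathrm{ind}}$ is the set of all sequences of independent, zero-mean random variables with the same property. $\mathscr{S}_{\mathrm{cor}}$ is the set of all symmetric real matrices of size $2n_x+2n_w$ partitioned (with block sizes $2n_x,n_w,n_w$) as $$\Sigma=\begin{pmatrix}\Sigma_{\chi\chi}&\Sigma_{\chi w}&\Sigma_{\chi\hat w}\\ \Sigma_{w\chi}&\Sigma_{ww}&\Sigma_{w\hat w}\\ \Sigma_{\hat w\chi}&\Sigma_{\hat ww}&\Sigma_{\hat w\hat w}\end{pmatrix};$$ $\mathscr{S}_{\mathrm{ind}}$ is the subset of those with $\Sigma_{\chi w}=0$ and $\Sigma_{\chi\hat w}=0$ (and hence $\Sigma_{w\chi}=0$, $\Sigma_{\hat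 w\chi}=0$). *)

theory Defs
  imports "HOL-Probability.Probability"
begin

subsection \<open>Block matrices\<close>

definition hcat :: "real^'a^'m \<Rightarrow> real^'b^'m \<Rightarrow> real^('a + 'b)^'m" where
  "hcat A B = (\<chi> i j. case j of Inl a \<Rightarrow> A $ i $ a | Inr b \<Rightarrow> B $ i $ b)"

definition vcat :: "real^'n^'a \<Rightarrow> real^'n^'b \<Rightarrow> real^'n^('a + 'b)" where
  "vcat A B = (\<chi> i. case i of Inl a \<Rightarrow> A $ a | Inr b \<Rightarrow> B $ b)"

definition symmetric_matrix :: "real^'n^'n \<Rightarrow> bool" where
  "symmetric_matrix S \<longleftrightarrow> transpose S = S"

definition psd :: "real^'n^'n \<Rightarrow> bool" where
  "psd S \<longleftrightarrow> symmetric_matrix S \<and> (\<forall>v. 0 \<le> v \<bullet> (S *v v))"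

definition complex_eigenvalue :: "real^'n^'n \<Rightarrow> complex \<Rightarrow> bool" where
  "complex_eigenvalue A c \<longleftrightarrow>
     (\<exists>v :: complex^'n. v \<noteq> 0 \<and> map_matrix complex_of_real A *v v = c *s v)"

definition stable_matrix :: "real^'n^'n \<Rightarrow> bool" where
  "stable_matrix A \<longleftrightarrow> (\<forall>c. complex_eigenvalue A c \<longrightarrow> cmod c < 1)"

subsection \<open>Normal distributions and probability spaces\<close>

text \<open>A measure on Euclidean space is zero-mean normal if all its one-dimensional
  marginals are zero-mean normal; the covariance may be singular, so marginals may be
  the point mass at 0 (the case \<open>s = 0\<close>).\<close>

definition zero_mean_normal :: "(real^'n) measure \<Rightarrow> bool" where
  "zero_mean_normal P \<longleftrightarrow> prob_space P \<and> sets P = sets borel \<and>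
     (\<forall>v. \<exists>s\<ge>0. distr P borel (\<lambda>x. v \<bullet> x) =
        (if s = 0 then return borel 0
         else density lborel (\<lambda>y. ennreal (normal_density 0 s y))))"

definition second_moment :: "(real^'n) measure \<Rightarrow> real^'n^'n" where
  "second_moment P = (\<chi> i j. \<integral>x. x $ i * x $ j \<partial>P)"

definition separable_metric_prob_space :: "'a measure \<Rightarrow> bool" where
  "separable_metric_prob_space M \<longleftrightarrow> prob_space M \<and>
     (\<exists>m. mspace m = space M \<and> separable_space (mtopology_of m) \<and>
          sets M = sigma_sets (space M) {U. openin (mtopology_of m) U})"

definition L2 :: "'a measure \<Rightarrow> ('a \<Rightarrow> real^'n) set" where
  "L2 M = {f. f \<in> borel_measurable M \<and> integrable M (\<lambda>\<omega>. (norm (f \<omega>))\<^sup>2)}"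

subsection \<open>The two problems\<close>

text \<open>The selector for the two cases: \<open>Cor\<close> stands for correlated disturbances,
  \<open>Ind\<close> for independent zero-mean ones.\<close>

datatype disturbance_class = Cor | Ind

primrec cl_state ::
  "real^'s^'s \<Rightarrow> real^'w^'s \<Rightarrow> (nat \<Rightarrow> 'a \<Rightarrow> real^'w) \<Rightarrow> nat \<Rightarrow> 'a \<Rightarrow> real^'s" where
  "cl_state A B w 0 = (\<lambda>\<omega>. 0)"
| "cl_state A B w (Suc t) = (\<lambda>\<omega>. A *v cl_state A B w t \<omega> + B *v w t \<omega>)"

definition cl_output ::
  "real^'s^'s \<Rightarrow> real^'w^'s \<Rightarrow> real^'s^'z \<Rightarrow> real^'w^'z \<Rightarrow> (nat \<Rightarrow> 'a \<Rightarrow> real^'w) \<Rightarrow>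
   nat \<Rightarrow> 'a \<Rightarrow> real^'z" where
  "cl_output A B C D w t = (\<lambda>\<omega>. C *v cl_state A B w t \<omega> + D *v w t \<omega>)"

definition average_cost ::
  "real^'s^'s \<Rightarrow> real^'w^'s \<Rightarrow> real^'s^'z \<Rightarrow> real^'w^'z \<Rightarrow> 'a measure \<Rightarrow>
   (nat \<Rightarrow> 'a \<Rightarrow> real^'w) \<Rightarrow> ereal" where
  "average_cost A B C D M w =
     limsup (\<lambda>T. ereal (1 / real T * (\<Sum>t<T. \<integral>\<omega>. (norm (cl_output A B C D w t \<omega>))\<^sup>2 \<partial>M)))"

definition feasible_II ::
  "disturbance_class \<Rightarrow> real \<Rightarrow> (real^'w) measure \<Rightarrow> 'a measure \<Rightarrow>
   (nat \<Rightarrow> 'a \<Rightarrow> real^'w) \<Rightarrow> (nat \<Rightarrow> 'a \<Rightarrow> real^'w) \<Rightarrow> bool" where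
  "feasible_II d \<gamma> P M w w' \<longleftrightarrow>
     (\<forall>t. w t \<in> L2 M \<and> w' t \<in> L2 M \<and>
          (\<integral>\<omega>. (norm (w t \<omega> - w' t \<omega>))\<^sup>2 \<partial>M) \<le> \<gamma>\<^sup>2 \<and>
          distr M borel (w' t) = P) \<and>
     (d = Ind \<longrightarrow>
        prob_space.indep_vars M (\<lambda>_. borel) w UNIV \<and> (\<forall>t. (\<integral>\<omega>. w t \<omega> \<partial>M) = 0))"

text \<open>The probability space is part of a candidate solution. HOL cannot quantify over its
  type, but a separable metric space has at most continuum many points, so nothing is lost by
  letting its underlying set be an arbitrary subset of the type \<open>nat \<Rightarrow> real\<close>, with an arbitrary
  separable metric on it: see lemma \<open>average_cost_le_value_II\<close>.\<close>

definition candidates_II ::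
  "disturbance_class \<Rightarrow> real \<Rightarrow> (real^'w) measure \<Rightarrow>
   ((nat \<Rightarrow> real) measure \<times> (nat \<Rightarrow> (nat \<Rightarrow> real) \<Rightarrow> real^'w) \<times> (nat \<Rightarrow> (nat \<Rightarrow> real) \<Rightarrow> real^'w)) set"
  where
  "candidates_II d \<gamma> P =
     {(M, w, w'). separable_metric_prob_space M \<and> feasible_II d \<gamma> P M w w'}"

definition value_II ::
  "disturbance_class \<Rightarrow> real \<Rightarrow> (real^'w) measure \<Rightarrow>
   real^'s^'s \<Rightarrow> real^'w^'s \<Rightarrow> real^'s^'z \<Rightarrow> real^'w^'z \<Rightarrow> ereal" where
  "value_II d \<gamma> P A B C D = (SUP (M, w, w') \<in> candidates_II d \<gamma> P. average_cost A B C D M w)"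

text \<open>Every separable metric probability space is isomorphic to one carried by a subset of
  \<open>nat \<Rightarrow> real\<close>: a point is encoded by its distances to a dense sequence, and the metric
  is transported along this injection.\<close>

lemma separable_metric_prob_space_copy:
  fixes M :: "'a measure"
  assumes "separable_metric_prob_space M"
  obtains N :: "(nat \<Rightarrow> real) measure" and h :: "(nat \<Rightarrow> real) \<Rightarrow> 'a"
  where "separable_metric_prob_space N" "h \<in> measurable N M" "distr N M h = M"
proof -
  from assms obtain m where "prob_space M" and m: "mspace m = space M"
    and sep: "separable_space (mtopology_of m)"
    and sM: "sets M = sigma_sets (space M) {U. openin (mtopology_of m) U}"
    unfolding separable_metric_prob_space_def by blast
  define S where "S = space M"
  have S: "mspace m = S" "space M = S" using m by (auto simp: S_def)
  interpret M: prob_space M by fact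
  interpret ms: Metric_space S "mdist m"
    using Metric_space_mspace_mdist[of m] S by simp
  have mt: "mtopology_of m = ms.mtopology"
    by (simp add: mtopology_of_def S)
  obtain Q where Q: "countable Q" "Q \<subseteq> S" "ms.mtopology closure_of Q = S"
    using sep unfolding mt separable_space_def by auto
  have dense: "\<exists>y\<in>Q. mdist m x y < r" if "x \<in> S" "r > 0" for x r
    using that Q(3) unfolding ms.metric_closure_of by fastforce
  have "Q \<noteq> {}"
    using dense[of _ 1] M.not_empty S by auto
  then have q: "range (from_nat_into Q) = Q"
    using Q(1) by (rule range_from_nat_into)
  define q where "q = from_nat_into Q"
  note q = q[folded q_def]
  define g where "g x = (\<lambda>n::nat. mdist m x (q n))" for x
  have inj: "inj_on g S"
  proof (rule inj_onI, rule ccontr)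
    fix x y assume xy: "x \<in> S" "y \<in> S" "g x = g y" "x \<noteq> y"
    then have "mdist m x y > 0"
      using ms.mdist_pos_less by simp
    then obtain n where n: "mdist m x (q n) < mdist m x y / 2"
      using dense[of x "mdist m x y / 2"] xy q by auto
    have "q n \<in> S" using q Q(2) by auto
    then have "mdist m x y \<le> mdist m x (q n) + mdist m y (q n)"
      using ms.triangle[of x "q n" y] xy ms.commute[of y "q n"] by simp
    moreover have "mdist m y (q n) = mdist m x (q n)"
      using xy(3) by (metis g_def)
    ultimately show False using n by simp
  qed
  define h where "h = the_inv_into S g"
  define S' where "S' = g ` S"
  have hg: "h (g x) = x" if "x \<in> S" for x
    using inj that by (simp add: h_def the_inv_into_f_f)
  have hS: "h y \<in> S" and gh: "g (h y) = y" if "y \<in> S'" for y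
    using that hg by (auto simp: S'_def)
  have gS: "g x \<in> S'" if "x \<in> S" for x
    using that by (simp add: S'_def)
  define d where "d a b = mdist m (h a) (h b)" for a b
  interpret ms': Metric_space S' d
  proof
    show "d x y = 0 \<longleftrightarrow> x = y" if "x \<in> S'" "y \<in> S'" for x y
      using that hS gh ms.zero unfolding d_def by metis
    show "d x z \<le> d x y + d y z" if "x \<in> S'" "y \<in> S'" "z \<in> S'" for x y z
      using that hS ms.triangle unfolding d_def by blast
  qed (auto simp: d_def ms.commute)
  have ball: "ms'.mball y r = h -` ms.mball (h y) r \<inter> S'" if "y \<in> S'" for y r
    using that hS by (auto simp: ms'.mball_def ms.mball_def d_def)
  have open1: "openin ms'.mtopology (h -` U \<inter> S')" if "openin ms.mtopology U" for U
    unfolding ms'.openin_mtopology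
  proof (intro conjI allI impI)
    fix y assume y: "y \<in> h -` U \<inter> S'"
    then obtain r where "r > 0" "ms.mball (h y) r \<subseteq> U"
      using \<open>openin ms.mtopology U\<close> unfolding ms.openin_mtopology by auto
    then show "\<exists>r>0. ms'.mball y r \<subseteq> h -` U \<inter> S'"
      using ball[of y] y by blast
  qed auto
  have open2: "\<exists>U. openin ms.mtopology U \<and> V = h -` U \<inter> S'" if "openin ms'.mtopology V" for V
  proof (intro exI conjI)
    have V: "V \<subseteq> S'" using \<open>openin ms'.mtopology V\<close> unfolding ms'.openin_mtopology by auto
    show "openin ms.mtopology (h ` V)"
      unfolding ms.openin_mtopology
    proof (intro conjI allI impI)
      show "h ` V \<subseteq> S" using V hS by auto
      fix x assume "x \<in> h ` V"
      then obtain y where y: "y \<in> V" "x = h y" by auto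
      then obtain r where r: "r > 0" "ms'.mball y r \<subseteq> V"
        using \<open>openin ms'.mtopology V\<close> unfolding ms'.openin_mtopology by auto
      have "z \<in> h ` V" if "z \<in> ms.mball x r" for z
      proof -
        have "z \<in> S" using that by auto
        then have "g z \<in> ms'.mball y r"
          using that y V by (subst ball) (auto simp: S'_def hg)
        then show ?thesis using r \<open>z \<in> S\<close> hg by force
      qed
      then show "\<exists>r>0. ms.mball x r \<subseteq> h ` V" using r by blast
    qed
    have "inj_on h S'" by (metis gh inj_onI)
    then show "V = h -` (h ` V) \<inter> S'"
      using V by (auto dest: inj_onD)
  qed
  define N0 where "N0 = vimage_algebra S' h M"
  have h_N0: "h \<in> measurable N0 M"
    unfolding N0_def by (rule measurable_vimage_algebra1) (auto simp: hS S)
  have g_N0: "g \<in> measurable M N0"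
    unfolding N0_def
  proof (rule measurable_vimage_algebra2)
    show "g \<in> space M \<rightarrow> S'" by (auto simp: S'_def S)
    have "(\<lambda>x. x) \<in> measurable M M" by simp
    then show "(\<lambda>x. h (g x)) \<in> measurable M M"
      by (rule measurable_cong[THEN iffD1, rotated]) (auto simp: hg S)
  qed
  define N where "N = distr M N0 g"
  have spN: "space N = S'" by (simp add: N_def N0_def)
  have setsN: "sets N = sigma_sets S' {V. openin ms'.mtopology V}"
  proof -
    have "sets N = {h -` A \<inter> S' | A. A \<in> sigma_sets S {U. openin ms.mtopology U}}"
      using hS sM by (simp add: N_def N0_def sets_vimage_algebra2 S mt)
    also have "\<dots> = sigma_sets S' {h -` A \<inter> S' | A. A \<in> {U. openin ms.mtopology U}}"
      by (rule sigma_sets_vimage_commute) (auto simp: hS)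
    also have "{h -` A \<inter> S' | A. A \<in> {U. openin ms.mtopology U}} = {V. openin ms'.mtopology V}"
      using open1 open2 by blast
    finally show ?thesis .
  qed
  have "separable_space ms'.mtopology"
    unfolding separable_space_def
  proof (intro exI conjI)
    show "countable (g ` Q)" using Q by simp
    have "g ` Q \<subseteq> S'" using Q by (auto simp: S'_def)
    then show "g ` Q \<subseteq> topspace ms'.mtopology" by simp
    show "ms'.mtopology closure_of (g ` Q) = topspace ms'.mtopology"
    proof -
      have "\<exists>y\<in>g ` Q. y \<in> ms'.mball x r" if "x \<in> S'" "r > 0" for x r
      proof -
        have "\<exists>y\<in>Q. mdist m (h x) y < r"
          using dense hS that by simp
        then obtain y where "y \<in> Q" "mdist m (h x) y < r" by blast
        then have "y \<in> S" "g y \<in> ms'.mball x r"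
          using Q(2) that ms'.in_mball[of "g y" x r] by (auto simp: d_def hg gS)
        then show ?thesis using \<open>y \<in> Q\<close> by blast
      qed
      then show ?thesis unfolding ms'.metric_closure_of by auto
    qed
  qed
  moreover have "prob_space N"
    unfolding N_def by (rule M.prob_space_distr) (rule g_N0)
  ultimately have "separable_metric_prob_space N"
    unfolding separable_metric_prob_space_def
    by (intro conjI exI[of _ "metric (S', d)"]) (auto simp: spN setsN)
  moreover have "h \<in> measurable N M"
    using h_N0 by (simp add: N_def)
  moreover have "distr N M h = M"
  proof -
    have "distr N M h = distr M M (h \<circ> g)"
      unfolding N_def by (rule distr_distr[OF h_N0 g_N0])
    also have "\<dots> = distr M M (\<lambda>x. x)"
      by (rule distr_cong) (auto simp: hg S)
    finally show ?thesis by simp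
  qed
  ultimately show ?thesis using that by blast
qed

lemma average_cost_le_value_II:
  fixes M :: "'a measure" and P :: "(real^'w) measure"
    and A :: "real^'s^'s" and B :: "real^'w^'s" and C :: "real^'s^'z" and D :: "real^'w^'z"
  assumes "separable_metric_prob_space M" and feas: "feasible_II d \<gamma> P M w w'"
  shows "average_cost A B C D M w \<le> value_II d \<gamma> P A B C D"
proof -
  obtain N :: "(nat \<Rightarrow> real) measure" and h :: "(nat \<Rightarrow> real) \<Rightarrow> 'a"
    where N: "separable_metric_prob_space N" and h: "h \<in> measurable N M" and NM: "distr N M h = M"
    using separable_metric_prob_space_copy[OF assms(1)] by blast
  interpret M: prob_space M
    using assms(1) by (simp add: separable_metric_prob_space_def)
  interpret N: prob_space N
    using N by (simp add: separable_metric_prob_space_def)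
  have w [measurable]: "w t \<in> borel_measurable M" "w' t \<in> borel_measurable M" for t
    using feas by (auto simp: feasible_II_def L2_def)
  have int: "(\<integral>\<omega>. f (h \<omega>) \<partial>N) = (\<integral>\<omega>. f \<omega> \<partial>M)" if "f \<in> borel_measurable M"
    for f :: "'a \<Rightarrow> 'b :: {banach, second_countable_topology}"
    using integral_distr[OF h that] NM by simp
  have intb: "integrable N (\<lambda>\<omega>. f (h \<omega>))" if "integrable M f" for f :: "'a \<Rightarrow> real"
    using integrable_distr[OF h, of f] that NM by simp
  define v where "v = (\<lambda>t \<omega>. w t (h \<omega>))"
  define v' where "v' = (\<lambda>t \<omega>. w' t (h \<omega>))"
  have distr: "distr N borel (\<lambda>\<omega>. f (h \<omega>)) = distr M borel f" if "f \<in> borel_measurable M"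
    for f :: "'a \<Rightarrow> 'b :: topological_space"
    using distr_distr[OF that h] NM by (simp add: comp_def)
  have mv': "v' t \<in> borel_measurable N" for t
    unfolding v'_def using measurable_compose[OF h w(2)] .
  have mv: "v t \<in> borel_measurable N" for t
    unfolding v_def using measurable_compose[OF h w(1)] .
  have "feasible_II d \<gamma> P N v v'"
    unfolding feasible_II_def
  proof (intro conjI allI impI)
    fix t
    show "v t \<in> L2 N" "v' t \<in> L2 N"
      using feas intb mv mv' by (auto simp: feasible_II_def L2_def v_def v'_def)
    show "(\<integral>\<omega>. (norm (v t \<omega> - v' t \<omega>))\<^sup>2 \<partial>N) \<le> \<gamma>\<^sup>2"
      using feas int[of "\<lambda>\<omega>. (norm (w t \<omega> - w' t \<omega>))\<^sup>2"]
      by (auto simp: feasible_II_def v_def v'_def)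
    show "distr N borel (v' t) = P"
      using feas distr[OF w(2), of t] by (auto simp: feasible_II_def v'_def)
  next
    fix t assume "d = Ind"
    then show "(\<integral>\<omega>. v t \<omega> \<partial>N) = 0"
      using feas int[OF w(1)] by (auto simp: feasible_II_def v_def)
  next
    assume "d = Ind"
    then have ind: "M.indep_vars (\<lambda>_. borel) w UNIV"
      using feas by (simp add: feasible_II_def)
    have "distr N (\<Pi>\<^sub>M i\<in>UNIV. borel) (\<lambda>\<omega>. \<lambda>i\<in>UNIV. v i \<omega>)
        = distr M (\<Pi>\<^sub>M i\<in>UNIV. borel) (\<lambda>\<omega>. \<lambda>i\<in>UNIV. w i \<omega>)"
    proof -
      have "(\<lambda>\<omega>. \<lambda>i\<in>UNIV. w i \<omega>) \<in> measurable M (\<Pi>\<^sub>M i\<in>UNIV. borel)"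
        by measurable
      from distr_distr[OF this h] NM show ?thesis by (simp add: comp_def v_def)
    qed
    also have "\<dots> = (\<Pi>\<^sub>M i\<in>UNIV. distr M borel (w i))"
      using ind by (subst (asm) M.indep_vars_iff_distr_eq_PiM) auto
    also have "\<dots> = (\<Pi>\<^sub>M i\<in>UNIV. distr N borel (v i))"
      using distr[OF w(1)] by (simp add: v_def)
    finally show "N.indep_vars (\<lambda>_. borel) v UNIV"
      using mv by (subst N.indep_vars_iff_distr_eq_PiM) auto
  qed
  then have "average_cost A B C D N v \<le> value_II d \<gamma> P A B C D"
    using N unfolding value_II_def candidates_II_def
    by (intro SUP_upper2[of "(N, v, v')"]) auto
  moreover have "average_cost A B C D N v = average_cost A B C D M w"
  proof -
    have state: "cl_state A B v t \<omega> = cl_state A B w t (h \<omega>)" for t \<omega>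
      by (induction t) (auto simp: v_def)
    have mult [measurable]: "(*v) X \<in> borel_measurable borel" for X :: "real^'p^'q"
      by (intro borel_measurable_continuous_onI linear_continuous_on)
         (simp add: linear_conv_bounded_linear[symmetric])
    have [measurable]: "cl_state A B w t \<in> borel_measurable M" for t
      by (induction t) simp_all
    have "(\<lambda>\<omega>. (norm (cl_output A B C D w t \<omega>))\<^sup>2) \<in> borel_measurable M" for t
      unfolding cl_output_def by measurable
    note int[OF this]
    moreover have "cl_output A B C D v t \<omega> = cl_output A B C D w t (h \<omega>)" for t \<omega>
      unfolding cl_output_def state by (simp add: v_def)
    ultimately show ?thesis
      by (simp add: average_cost_def)
  qed
  ultimately show ?thesis by simp
qed

text \<open>The index type \<open>'s + ('w + 'w)\<close> carries the partition of \<open>\<Sigma>\<close> into the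
  blocks of the state, the disturbance and the nominal disturbance.\<close>

definition covariance_class ::
  "disturbance_class \<Rightarrow> (real^('s::finite + ('w::finite + 'w))^('s + ('w + 'w))) set" where
  "covariance_class d =
     (case d of
        Cor \<Rightarrow> {S. symmetric_matrix S}
      | Ind \<Rightarrow> {S. symmetric_matrix S \<and>
          (\<forall>i j. S $ Inl i $ Inr (Inl j) = 0 \<and> S $ Inl i $ Inr (Inr j) = 0)})"

definition feasible_III ::
  "disturbance_class \<Rightarrow> real \<Rightarrow> real^'w^'w \<Rightarrow> real^'s^'s \<Rightarrow> real^'w^'s \<Rightarrow>
   (real^('s + ('w + 'w))^('s + ('w + 'w))) set" where
  "feasible_III d \<gamma> Snom A B =
     {S \<in> covariance_class d.
        (let E = hcat (mat 1) (hcat 0 0); F = hcat A (hcat B 0)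
         in E ** S ** transpose E = F ** S ** transpose F) \<and>
        (let G = vcat (hcat 0 (hcat (mat 1) 0)) (hcat 0 (hcat 0 (mat 1)))
         in \<gamma>\<^sup>2 \<ge> trace (G ** S ** transpose G **
                       vcat (hcat (mat 1) (- mat 1)) (hcat (- mat 1) (mat 1)))) \<and>
        (let H = hcat 0 (hcat 0 (mat 1))
         in Snom = H ** S ** transpose H) \<and>
        psd S}"

definition value_III ::
  "disturbance_class \<Rightarrow> real \<Rightarrow> real^'w^'w \<Rightarrow>
   real^'s^'s \<Rightarrow> real^'w^'s \<Rightarrow> real^'s^'z \<Rightarrow> real^'w^'z \<Rightarrow> ereal" where
  "value_III d \<gamma> Snom A B C D =
     (SUP S \<in> feasible_III d \<gamma> Snom A B.
        let K = hcat C (hcat D 0) in ereal (trace (K ** S ** transpose K)))"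

end

theory Submission
  imports Defs "HOL-Computational_Algebra.Fundamental_Theorem_Algebra"
begin

text \<open>
  Write \<open>A, B, C, D\<close> for the closed-loop matrices, \<open>F = (A B 0)\<close> and \<open>K = (C D 0)\<close>. Only second
  moments matter on both sides. For a candidate \<open>(w, w')\<close> of Problem (II), the joint vector
  \<open>\<xi>(t) = (\<chi>(t), w(t), w'(t))\<close> has a positive semidefinite moment matrix \<open>S(t)\<close>, and what
  Problem (III) asks of a matrix is linear in \<open>S(t)\<close>: the expected squared output norm is
  \<open>tr (K S(t) K\<^sup>T)\<close>, the distance budget and the nominal covariance hold for each \<open>t\<close>, and the
  closed loop says that the state block of \<open>S(t + 1)\<close> is \<open>F S(t) F\<^sup>T\<close>.

  \<^bold>\<open>(II) is at most (III).\<close> Consider the time averages of \<open>S(t)\<close> over \<open>t < T\<close>. They satisfy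
  the stationarity constraint up to \<open>E \<chi>(T) \<chi>(T)\<^sup>T / T\<close>, and they are bounded, because stability
  makes the powers of the closed-loop matrix summable. Hence along times that realize the limsup
  of the cost, a subsequence converges to a matrix that satisfies the constraints and attains the
  average cost (\<open>average_cost_attained_by_covariance\<close>). For independent disturbances the limit must
  also have vanishing correlations with the state. Here \<open>\<chi>(t)\<close> and \<open>w(t)\<close> are uncorrelated, but
  \<open>\<chi>(t)\<close> and \<open>w'(t)\<close> need not be. Averaging the limit with its image under the
  sign flip of the state (\<open>decouple\<close>) removes these correlations and preserves the
  constraints and the objective.

  \<^bold>\<open>(III) is at most (II).\<close> Factor a feasible matrix as \<open>S = L L\<^sup>T\<close> and take standard Gaussian
  vectors. In the correlated case a single Gaussian vector \<open>g\<close> is enough. Stationarity says that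
  the rows of the state block of \<open>L\<close> and the rows of \<open>F L\<close> have the same Gram matrix, so some
  orthogonal \<open>U\<close> carries the first to the second. Then \<open>L U\<^sup>t g\<close> is a stationary trajectory of
  the closed loop with moment matrix \<open>S\<close> at every time. Started at \<open>0\<close> instead, the state
  differs from the stationary one by \<open>A\<^sup>t\<close> applied to its initial value, which vanishes in the
  limit (\<open>feasible_III_Cor_attained\<close>). In the independent case use independent copies \<open>g(t)\<close>; the
  state covariance then solves a Lyapunov recursion and converges to the state block of \<open>S\<close>
  (\<open>feasible_III_Ind_attained\<close>).

  The nominal component must have exactly the prescribed law, for every \<open>t\<close>. It is a linear image
  of a Gaussian vector with the right covariance, and a zero-mean normal distribution is determined
  by its covariance: its characteristic function is, and characteristic functions determine
  measures on Euclidean space (\<open>measure_eqI_iexp_inner\<close>, \<open>distr_std_gaussian_eq\<close>).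
\<close>

section \<open>Powers of a stable matrix\<close>

text \<open>\<open>poly_act M p v\<close> is \<open>p(M) v\<close>. Horner's scheme avoids forming matrix powers and gives the
  recursion along \<open>pCons\<close> directly.\<close>

definition poly_act :: "complex^'n^'n \<Rightarrow> complex poly \<Rightarrow> complex^'n \<Rightarrow> complex^'n" where
  "poly_act M p v = fold_coeffs (\<lambda>c y. c *s v + M *v y) p 0"

lemma poly_act_0 [simp]: "poly_act M 0 v = 0"
  by (simp add: poly_act_def)

lemma poly_act_pCons [simp]: "poly_act M (pCons c p) v = c *s v + M *v poly_act M p v"
  by (cases "p = 0 \<and> c = 0") (auto simp: poly_act_def)

lemma poly_act_add: "poly_act M (p + q) v = poly_act M p v + poly_act M q v"
  by (induction p q rule: poly_induct2) (auto simp: vector_sadd_rdistrib matrix_vector_right_distrib)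

lemma poly_act_smult: "poly_act M (smult c p) v = c *s poly_act M p v"
  by (induction p) (auto simp: vector_add_ldistrib vector_smult_assoc vector_scalar_commute)

lemma poly_act_mult: "poly_act M (p * q) v = poly_act M p (poly_act M q v)"
  by (induction p) (auto simp: poly_act_add poly_act_smult)

lemma poly_act_monom: "poly_act M (monom c i) v = c *s (((*v) M ^^ i) v)"
  by (induction i) (auto simp: monom_0 monom_Suc vector_scalar_commute)

lemma poly_act_sum: "poly_act M (\<Sum>i\<in>I. p i) v = (\<Sum>i\<in>I. poly_act M (p i) v)"
  by (induction I rule: infinite_finite_induct) (auto simp: poly_act_add)

text \<open>The iterates \<open>v, M v, M\<^sup>2 v, ...\<close> cannot all be linearly independent; a dependency among
  them is a polynomial that annihilates \<open>v\<close>. Real coefficients are enough, so the real dimension of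
  \<open>complex^'n\<close> can be used. Two equal iterates are treated apart, because dependence of a set
  does not see repetitions.\<close>

lemma ex_annihilating_poly:
  fixes M :: "complex^'n^'n" and v :: "complex^'n"
  obtains p where "p \<noteq> 0" "poly_act M p v = 0"
proof -
  define f where "f i = ((*v) M ^^ i) v" for i
  define n where "n = DIM(complex^'n)"
  show ?thesis
  proof (cases "inj_on f {..n}")
    case False
    then obtain i j where ij: "i \<noteq> j" "f i = f j" by (auto simp: inj_on_def)
    have "coeff (monom 1 i + monom (- 1 :: complex) j) i = 1" using ij by simp
    then have "monom 1 i + monom (- 1 :: complex) j \<noteq> 0" by (metis coeff_0 zero_neq_one)
    moreover have "poly_act M (monom 1 i + monom (- 1) j) v = 0"
      using ij by (simp add: poly_act_add poly_act_monom f_def vec_eq_iff)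
    ultimately show ?thesis using that by blast
  next
    case True
    then have "card (f ` {..n}) = Suc n" by (simp add: card_image)
    then have "dependent (f ` {..n})"
      using independent_bound[of "f ` {..n}"] by (auto simp: n_def)
    then obtain u where u: "(\<Sum>x\<in>f ` {..n}. u x *\<^sub>R x) = 0" "\<exists>x\<in>f ` {..n}. u x \<noteq> 0"
      by (subst (asm) dependent_finite) auto
    define p where "p = (\<Sum>i\<le>n. monom (complex_of_real (u (f i))) i)"
    obtain k where k: "k \<le> n" "u (f k) \<noteq> 0" using u(2) by auto
    have "coeff p k = of_real (u (f k))"
      using k by (simp add: p_def coeff_sum)
    then have "p \<noteq> 0" using k by auto
    have "poly_act M p v = (\<Sum>i\<le>n. u (f i) *\<^sub>R f i)"
      unfolding p_def poly_act_sum poly_act_monom f_def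
      by (intro sum.cong refl, subst vec_eq_iff) (simp, simp add: scaleR_conv_of_real)
    also have "\<dots> = (\<Sum>x\<in>f ` {..n}. u x *\<^sub>R x)"
      unfolding sum.reindex[OF True] by simp
    also note u(1)
    finally have "poly_act M p v = 0" .
    then show ?thesis using that \<open>p \<noteq> 0\<close> by blast
  qed
qed

text \<open>Summing the recursion gives \<open>s \<le> a 0 + r s + \<Sum>u\<close> for every partial sum \<open>s\<close>, which can be
  solved for \<open>s\<close>.\<close>

lemma summable_contraction_recursion:
  fixes a u :: "nat \<Rightarrow> real"
  assumes a: "\<And>k. 0 \<le> a k" and step: "\<And>k. a (Suc k) \<le> r * a k + u k"
    and r: "0 \<le> r" "r < 1" and u: "summable u" "\<And>k. 0 \<le> u k"
  shows "summable a"
proof (rule summableI_nonneg_bounded)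
  fix n
  have "(\<Sum>k<n. a k) \<le> (\<Sum>k<Suc n. a k)" using a by simp
  also have "\<dots> = a 0 + (\<Sum>k<n. a (Suc k))" by (rule sum.lessThan_Suc_shift)
  also have "\<dots> \<le> a 0 + (\<Sum>k<n. r * a k + u k)" by (intro add_mono sum_mono step) auto
  also have "\<dots> = a 0 + r * (\<Sum>k<n. a k) + (\<Sum>k<n. u k)"
    by (simp add: sum.distrib sum_distrib_left)
  also have "\<dots> \<le> a 0 + r * (\<Sum>k<n. a k) + suminf u"
    using u by (intro add_mono sum_le_suminf) auto
  finally show "(\<Sum>k<n. a k) \<le> (a 0 + suminf u) / (1 - r)"
    using r by (simp add: field_simps)
qed (use a in auto)

lemma norm_vector_smult: "norm (c *s (v :: complex^'n)) = cmod c * norm v"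
  by (simp add: norm_vec_def norm_mult L2_set_def power_mult_distrib
      flip: sum_distrib_left real_sqrt_mult) (simp add: real_sqrt_mult)

text \<open>Split off a root \<open>z\<close> of the annihilating polynomial, \<open>p = (X - z) q\<close>. If \<open>cmod z < 1\<close>,
  then \<open>u = M v - z v\<close> is annihilated by \<open>q\<close>, and the orbit of \<open>v\<close> obeys a contracting recursion
  driven by the orbit of \<open>u\<close>. Otherwise \<open>z\<close> is not an eigenvalue, \<open>M - z\<close> is injective, and \<open>q\<close>
  already annihilates \<open>v\<close>.\<close>

lemma summable_orbit_complex:
  fixes M :: "complex^'n^'n"
  assumes eig: "\<And>c x. x \<noteq> 0 \<Longrightarrow> M *v x = c *s x \<Longrightarrow> cmod c < 1"
    and "p \<noteq> 0" "poly_act M p v = 0"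
  shows "summable (\<lambda>k. norm (((*v) M ^^ k) v))"
  using assms(2,3)
proof (induction "degree p" arbitrary: p v)
  case 0
  then obtain c where "p = [:c:]" "c \<noteq> 0" by (metis degree_eq_zeroE pCons_0_0)
  with 0 have "v = 0" by (simp add: vec_eq_iff)
  moreover have "((*v) M ^^ k) 0 = 0" for k by (induction k) auto
  ultimately show ?case by simp
next
  case (Suc n)
  have "\<not> constant (poly p)" using Suc.hyps(2) by (simp add: constant_degree)
  then obtain z where "poly p z = 0" using fundamental_theorem_of_algebra by blast
  then obtain q where p: "p = [:-z, 1:] * q" by (metis dvdE poly_eq_0_iff_dvd)
  have q: "q \<noteq> 0" "n = degree q"
  proof -
    show "q \<noteq> 0" using Suc.prems(1) p by auto
    then have "degree p = degree [:-z, 1:] + degree q"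
      unfolding p by (intro degree_mult_eq) auto
    then show "n = degree q" using Suc.hyps(2) by simp
  qed
  show ?case
  proof (cases "cmod z < 1")
    case True
    define u where "u = M *v v - z *s v"
    have "poly_act M q (poly_act M [:-z, 1:] v) = 0"
      using Suc.prems(2) unfolding p by (metis poly_act_mult mult.commute)
    moreover have "poly_act M [:-z, 1:] v = u" by (simp add: u_def vec_eq_iff)
    ultimately have u: "summable (\<lambda>k. norm (((*v) M ^^ k) u))"
      using Suc.hyps(1)[OF q(2) q(1)] by simp
    have orb: "((*v) M ^^ Suc k) v = z *s ((*v) M ^^ k) v + ((*v) M ^^ k) u" for k
      by (induction k)
        (auto simp: u_def matrix_vector_right_distrib vector_scalar_commute)
    have step: "norm (((*v) M ^^ Suc k) v) \<le> cmod z * norm (((*v) M ^^ k) v) + norm (((*v) M ^^ k) u)" for k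
      unfolding orb norm_vector_smult[symmetric] by (rule norm_triangle_ineq)
    show ?thesis
      by (rule summable_contraction_recursion[OF _ step _ True u]) simp_all
  next
    case False
    have "poly_act M [:-z, 1:] (poly_act M q v) = 0"
      using Suc.prems(2) unfolding p poly_act_mult .
    then have "M *v poly_act M q v = z *s poly_act M q v"
      by (simp add: vec_eq_iff algebra_simps)
    then have "poly_act M q v = 0" using eig False by blast
    then show ?thesis using Suc.hyps(1)[OF q(2) q(1)] by simp
  qed
qed

lemma stable_matrix_summable_orbit:
  fixes A :: "real^'n^'n" and x :: "real^'n"
  assumes "stable_matrix A"
  shows "summable (\<lambda>k. norm (((*v) A ^^ k) x))"
proof -
  define M where "M = map_matrix complex_of_real A"
  define cv where "cv y = (\<chi> i. complex_of_real (y $ i))" for y :: "real^'n"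
  have "M *v cv y = cv (A *v y)" for y
    by (simp add: M_def cv_def vec_eq_iff matrix_vector_mult_def map_matrix_def)
  then have "((*v) M ^^ k) (cv x) = cv (((*v) A ^^ k) x)" for k
    by (induction k) auto
  moreover have "norm (cv y) = norm y" for y
    by (simp add: cv_def norm_vec_def)
  moreover obtain p where "p \<noteq> 0" "poly_act M p (cv x) = 0" using ex_annihilating_poly .
  then have "summable (\<lambda>k. norm (((*v) M ^^ k) (cv x)))"
    using assms by (intro summable_orbit_complex[of M p])
      (auto simp: stable_matrix_def complex_eigenvalue_def M_def)
  ultimately show ?thesis by simp
qed

lemma stable_matrix_power_bound:
  fixes A :: "real^'n^'n"
  assumes "stable_matrix A"
  obtains a :: "nat \<Rightarrow> real" where "summable a" "\<And>k. 0 \<le> a k"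
    "\<And>k x. norm (((*v) A ^^ k) x) \<le> a k * norm x"
proof
  define a where "a k = (\<Sum>j\<in>UNIV. norm (((*v) A ^^ k) (axis j 1)))" for k
  show "summable a" unfolding a_def
    by (intro summable_sum stable_matrix_summable_orbit assms)
  show "0 \<le> a k" for k by (simp add: a_def sum_nonneg)
  have lin: "linear ((*v) A ^^ k)" for k
  proof (induction k)
    case (Suc k)
    show ?case
      unfolding funpow.simps by (rule linear_compose[OF Suc]) simp
  qed (auto intro!: linearI)
  show "norm (((*v) A ^^ k) x) \<le> a k * norm x" for k x
  proof -
    have "((*v) A ^^ k) x = ((*v) A ^^ k) (\<Sum>j\<in>UNIV. x $ j *\<^sub>R axis j 1)"
      by (simp add: basis_expansion flip: scalar_mult_eq_scaleR)
    also have "\<dots> = (\<Sum>j\<in>UNIV. x $ j *\<^sub>R ((*v) A ^^ k) (axis j 1))"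
      by (simp add: linear_sum[OF lin] linear_scale[OF lin])
    also have "norm \<dots> \<le> (\<Sum>j\<in>UNIV. norm x * norm (((*v) A ^^ k) (axis j 1)))"
      by (intro order_trans[OF norm_sum] sum_mono) (auto intro!: mult_right_mono component_le_norm_cart)
    finally show ?thesis by (simp add: a_def sum_distrib_left mult.commute)
  qed
qed

section \<open>Second moments of square-integrable random vectors\<close>

text \<open>The matrix \<open>E f g\<^sup>T\<close>; it is not centred.\<close>

definition cross_moment :: "'a measure \<Rightarrow> ('a \<Rightarrow> real^'m) \<Rightarrow> ('a \<Rightarrow> real^'n) \<Rightarrow> real^'n^'m" where
  "cross_moment M f g = (\<chi> i j. \<integral>\<omega>. f \<omega> $ i * g \<omega> $ j \<partial>M)"

lemma borel_measurable_matrix_vector_mult [measurable]: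
  fixes X :: "real^'p^'q"
  shows "(*v) X \<in> borel_measurable borel"
  by (intro borel_measurable_continuous_onI linear_continuous_on)
     (simp add: linear_conv_bounded_linear[symmetric])

lemma borel_measurable_vec_nth [measurable]: "(\<lambda>x :: real^'n. x $ i) \<in> borel_measurable borel"
  by (intro borel_measurable_continuous_onI continuous_intros)

lemma borel_measurable_vec_iff:
  fixes f :: "'a \<Rightarrow> real^'n"
  shows "f \<in> borel_measurable M \<longleftrightarrow> (\<forall>i. (\<lambda>x. f x $ i) \<in> borel_measurable M)"
  by (subst borel_measurable_euclidean_space) (auto simp: Basis_vec_def cart_eq_inner_axis)

lemma L2_D: "f \<in> L2 M \<Longrightarrow> f \<in> borel_measurable M" "f \<in> L2 M \<Longrightarrow> integrable M (\<lambda>\<omega>. (norm (f \<omega>))\<^sup>2)"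
  by (auto simp: L2_def)

lemma norm_sq_eq_sum: "(norm (x :: real^'n))\<^sup>2 = (\<Sum>i\<in>UNIV. x $ i * x $ i)"
  by (simp add: power2_norm_eq_inner inner_vec_def)

text \<open>Products of components are dominated by the sum of the two squared norms.\<close>

lemma L2_integrable_mult:
  fixes f :: "'a \<Rightarrow> real^'m" and g :: "'a \<Rightarrow> real^'n"
  assumes f: "f \<in> L2 M" and g: "g \<in> L2 M"
  shows "integrable M (\<lambda>\<omega>. f \<omega> $ i * g \<omega> $ j)"
proof (rule Bochner_Integration.integrable_bound)
  show "integrable M (\<lambda>\<omega>. (norm (f \<omega>))\<^sup>2 + (norm (g \<omega>))\<^sup>2)"
    using assms by (simp add: L2_D)
  show "(\<lambda>\<omega>. f \<omega> $ i * g \<omega> $ j) \<in> borel_measurable M"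
    using L2_D(1)[OF f] L2_D(1)[OF g]
    by (intro borel_measurable_times) (simp_all add: borel_measurable_vec_iff)
  show "AE \<omega> in M. norm (f \<omega> $ i * g \<omega> $ j) \<le> norm ((norm (f \<omega>))\<^sup>2 + (norm (g \<omega>))\<^sup>2)"
  proof (rule AE_I2)
    fix \<omega>
    have "\<bar>f \<omega> $ i\<bar> * \<bar>g \<omega> $ j\<bar> \<le> norm (f \<omega>) * norm (g \<omega>)"
      by (intro mult_mono component_le_norm_cart) auto
    also have "\<dots> \<le> (norm (f \<omega>))\<^sup>2 + (norm (g \<omega>))\<^sup>2"
      using sum_squares_bound[of "norm (f \<omega>)" "norm (g \<omega>)"]
        mult_nonneg_nonneg[OF norm_ge_zero norm_ge_zero, of "f \<omega>" "g \<omega>"] by linarith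
    finally show "norm (f \<omega> $ i * g \<omega> $ j) \<le> norm ((norm (f \<omega>))\<^sup>2 + (norm (g \<omega>))\<^sup>2)"
      by (simp add: abs_mult)
  qed
qed

lemma L2_matrix_vector_mult:
  fixes X :: "real^'n^'m"
  assumes f: "f \<in> L2 M"
  shows "(\<lambda>\<omega>. X *v f \<omega>) \<in> L2 M"
proof -
  note [measurable] = L2_D(1)[OF f]
  have "integrable M (\<lambda>\<omega>. (onorm ((*v) X))\<^sup>2 * (norm (f \<omega>))\<^sup>2)"
    using L2_D(2)[OF f] by simp
  then have "integrable M (\<lambda>\<omega>. (norm (X *v f \<omega>))\<^sup>2)"
  proof (rule Bochner_Integration.integrable_bound)
    show "AE \<omega> in M. norm ((norm (X *v f \<omega>))\<^sup>2) \<le> norm ((onorm ((*v) X))\<^sup>2 * (norm (f \<omega>))\<^sup>2)"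
    proof (rule AE_I2)
      fix \<omega>
      have "norm (X *v f \<omega>) \<le> onorm ((*v) X) * norm (f \<omega>)" by (rule onorm) simp
      then show "norm ((norm (X *v f \<omega>))\<^sup>2) \<le> norm ((onorm ((*v) X))\<^sup>2 * (norm (f \<omega>))\<^sup>2)"
        by (simp add: power_mono flip: power_mult_distrib)
    qed
  qed measurable
  then show ?thesis by (simp add: L2_def)
qed

lemma L2_add:
  fixes f g :: "'a \<Rightarrow> real^'m"
  assumes f: "f \<in> L2 M" and g: "g \<in> L2 M"
  shows "(\<lambda>\<omega>. f \<omega> + g \<omega>) \<in> L2 M"
proof -
  note [measurable] = L2_D(1)[OF f] L2_D(1)[OF g]
  have "integrable M (\<lambda>\<omega>. \<Sum>i\<in>UNIV. f \<omega> $ i * f \<omega> $ i + f \<omega> $ i * g \<omega> $ i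
      + (g \<omega> $ i * f \<omega> $ i + g \<omega> $ i * g \<omega> $ i))"
    using assms by (intro Bochner_Integration.integrable_sum Bochner_Integration.integrable_add
        L2_integrable_mult)
  then have "integrable M (\<lambda>\<omega>. (norm (f \<omega> + g \<omega>))\<^sup>2)"
    by (simp add: norm_sq_eq_sum distrib_left distrib_right add_ac)
  then show ?thesis by (simp add: L2_def)
qed

lemma (in prob_space) L2_imp_integrable:
  fixes f :: "'a \<Rightarrow> real^'n"
  assumes f: "f \<in> L2 M"
  shows "integrable M f"
proof -
  have "integrable M (\<lambda>\<omega>. norm (f \<omega>))"
    using measurable_compose[OF L2_D(1)[OF f] borel_measurable_norm] L2_D(2)[OF f]
    by (rule square_integrable_imp_integrable)
  then show ?thesis by (rule integrable_norm_iff[THEN iffD1, OF L2_D(1)[OF f]])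
qed

lemma L2_zero: "(\<lambda>\<omega>. 0) \<in> L2 M"
  by (simp add: L2_def)

lemma cross_moment_mult_left:
  fixes X :: "real^'n^'m"
  assumes "f \<in> L2 M" "g \<in> L2 M"
  shows "cross_moment M (\<lambda>\<omega>. X *v f \<omega>) g = X ** cross_moment M f g"
proof -
  have "(\<integral>\<omega>. (X *v f \<omega>) $ i * g \<omega> $ j \<partial>M) = (\<Sum>k\<in>UNIV. X $ i $ k * (\<integral>\<omega>. f \<omega> $ k * g \<omega> $ j \<partial>M))"
    for i j
  proof -
    have "(\<integral>\<omega>. (X *v f \<omega>) $ i * g \<omega> $ j \<partial>M)
        = (\<integral>\<omega>. (\<Sum>k\<in>UNIV. X $ i $ k * (f \<omega> $ k * g \<omega> $ j)) \<partial>M)"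
      by (simp add: matrix_vector_mult_def sum_distrib_right mult.assoc)
    then show ?thesis using assms by (simp add: L2_integrable_mult)
  qed
  then show ?thesis by (simp add: cross_moment_def matrix_matrix_mult_def vec_eq_iff)
qed

lemma cross_moment_transpose: "cross_moment M f g = transpose (cross_moment M g f)"
  by (simp add: cross_moment_def transpose_def mult.commute)

lemma cross_moment_mult_right:
  fixes X :: "real^'n^'m"
  assumes "f \<in> L2 M" "g \<in> L2 M"
  shows "cross_moment M f (\<lambda>\<omega>. X *v g \<omega>) = cross_moment M f g ** transpose X"
  using cross_moment_mult_left[OF assms(2,1), of X] cross_moment_transpose
  by (metis matrix_transpose_mul transpose_transpose)

lemma cross_moment_congruence:
  fixes X :: "real^'n^'m"
  assumes "f \<in> L2 M"
  shows "cross_moment M (\<lambda>\<omega>. X *v f \<omega>) (\<lambda>\<omega>. X *v f \<omega>) = X ** cross_moment M f f ** transpose X"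
  using assms
    by (simp add: cross_moment_mult_left cross_moment_mult_right L2_matrix_vector_mult matrix_mul_assoc)

lemma cross_moment_add_left:
  assumes "f \<in> L2 M" "g \<in> L2 M" "h \<in> L2 M"
  shows "cross_moment M (\<lambda>\<omega>. f \<omega> + g \<omega>) h = cross_moment M f h + cross_moment M g h"
  using assms by (simp add: cross_moment_def vec_eq_iff distrib_right L2_integrable_mult)

lemma cross_moment_sum_uncorrelated:
  fixes X :: "real^'p^'m" and Y :: "real^'q^'m"
  assumes f: "f \<in> L2 M" and g: "g \<in> L2 M" and "cross_moment M f g = 0"
  shows "cross_moment M (\<lambda>\<omega>. X *v f \<omega> + Y *v g \<omega>) (\<lambda>\<omega>. X *v f \<omega> + Y *v g \<omega>)
    = X ** cross_moment M f f ** transpose X + Y ** cross_moment M g g ** transpose Y"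
proof -
  let ?h = "\<lambda>\<omega>. X *v f \<omega> + Y *v g \<omega>"
  have h: "?h \<in> L2 M" using f g by (intro L2_add L2_matrix_vector_mult)
  have gf: "cross_moment M g f = 0"
    using assms(3) by (subst cross_moment_transpose) (simp add: transpose_def vec_eq_iff)
  have left: "cross_moment M ?h k = X ** cross_moment M f k + Y ** cross_moment M g k"
    if "k \<in> L2 M" for k :: "'a \<Rightarrow> real^'r"
    using f g that by (simp add: cross_moment_add_left cross_moment_mult_left L2_matrix_vector_mult)
  have right: "cross_moment M k ?h = cross_moment M k f ** transpose X + cross_moment M k g ** transpose Y"
    if "k \<in> L2 M" for k :: "'a \<Rightarrow> real^'r"
    using left[OF that] cross_moment_transpose[of M k ?h] cross_moment_transpose[of M k f]
      cross_moment_transpose[of M k g]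
    by (simp add: transpose_def vec_eq_iff matrix_matrix_mult_def mult.commute)
  have zero: "Z ** (0 :: real^'u^'v) = 0" "(0 :: real^'u^'v) ** Z' = 0"
    for Z :: "real^'v^'t" and Z' :: "real^'t^'u"
    by (simp_all add: matrix_matrix_mult_def vec_eq_iff)
  show ?thesis
    using f g by (simp add: left[OF h] right assms(3) gf zero matrix_mul_assoc)
qed

lemma integral_norm_sq_eq_trace:
  assumes "f \<in> L2 M"
  shows "(\<integral>\<omega>. (norm (f \<omega>))\<^sup>2 \<partial>M) = trace (cross_moment M f f)"
  using assms by (simp add: norm_sq_eq_sum trace_def cross_moment_def L2_integrable_mult)

lemma inner_matrix_vector_eq_sum:
  "(v :: real^'n) \<bullet> (S *v v) = (\<Sum>i\<in>UNIV. \<Sum>j\<in>UNIV. v $ i * S $ i $ j * v $ j)"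
  by (simp add: inner_vec_def matrix_vector_mult_def sum_distrib_left mult.assoc)

lemma integral_inner_sq:
  assumes "f \<in> L2 M"
  shows "(\<integral>\<omega>. (v \<bullet> f \<omega>)\<^sup>2 \<partial>M) = v \<bullet> (cross_moment M f f *v v)"
proof -
  have "(\<integral>\<omega>. (v \<bullet> f \<omega>)\<^sup>2 \<partial>M)
      = (\<integral>\<omega>. (\<Sum>i\<in>UNIV. \<Sum>j\<in>UNIV. v $ i * (f \<omega> $ i * f \<omega> $ j) * v $ j) \<partial>M)"
    by (simp add: power2_eq_square inner_vec_def sum_product mult_ac)
  also have "\<dots> = (\<Sum>i\<in>UNIV. \<Sum>j\<in>UNIV. v $ i * (\<integral>\<omega>. f \<omega> $ i * f \<omega> $ j \<partial>M) * v $ j)"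
    using assms by (simp add: L2_integrable_mult)
  finally show ?thesis by (simp add: inner_matrix_vector_eq_sum cross_moment_def)
qed

lemma cross_moment_psd:
  assumes "f \<in> L2 M"
  shows "psd (cross_moment M f f)"
  using cross_moment_transpose[of M f f] integral_inner_sq[OF assms, symmetric]
  by (simp add: psd_def symmetric_matrix_def)

lemma cross_moment_distr:
  assumes "h \<in> measurable M N" "f \<in> borel_measurable N" "g \<in> borel_measurable N"
  shows "cross_moment (distr M N h) f g = cross_moment M (\<lambda>\<omega>. f (h \<omega>)) (\<lambda>\<omega>. g (h \<omega>))"
  unfolding cross_moment_def vec_eq_iff
proof (intro allI, simp, rule integral_distr)
  show "(\<lambda>\<omega>. f \<omega> $ i * g \<omega> $ j) \<in> borel_measurable N" for i j
    using assms by (intro borel_measurable_times) (simp_all add: borel_measurable_vec_iff)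
qed (rule assms)

lemma trace_congruence_eq_norm_sq: "trace (X ** transpose X) = (norm (X :: real^'n^'m))\<^sup>2"
  by (simp add: trace_def matrix_matrix_mult_def transpose_def power2_norm_eq_inner inner_vec_def)

section \<open>Normal distributions are determined by their covariance\<close>

text \<open>Levy's uniqueness theorem for the finite measures with density \<open>g\<close>: normalize by the total
  mass, which the hypothesis at \<open>t = 0\<close> shows to be the same on both sides. If it is zero, \<open>g\<close>
  vanishes almost everywhere.\<close>

lemma weighted_char_unique:
  fixes M N :: "'a measure" and g X :: "'a \<Rightarrow> real"
  assumes M: "prob_space M" and N: "prob_space N" and sets: "sets M = sets N"
    and g: "g \<in> borel_measurable M" "\<And>x. 0 \<le> g x" "\<And>x. g x \<le> c"
    and X: "X \<in> borel_measurable M" and B: "B \<in> sets borel"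
    and eq: "\<And>t. (\<integral>x. g x *\<^sub>R iexp (t * X x) \<partial>M) = (\<integral>x. g x *\<^sub>R iexp (t * X x) \<partial>N)"
  shows "(\<integral>x. g x * indicator B (X x) \<partial>M) = (\<integral>x. g x * indicator B (X x) \<partial>N)"
proof -
  define m where "m = (\<integral>x. g x \<partial>M)"
  have "complex_of_real m = complex_of_real (\<integral>x. g x \<partial>N)"
    using eq[of 0] by (simp add: m_def scaleR_conv_of_real)
  then have mN: "m = (\<integral>x. g x \<partial>N)" by (simp only: of_real_eq_iff)
  have "0 \<le> m" unfolding m_def using g by simp
  define D where "D K = distr (density K (\<lambda>x. g x / m)) borel X" for K
  have ms: "f \<in> borel_measurable K" if "f \<in> borel_measurable M" "K = M \<or> K = N"
    for f :: "'a \<Rightarrow> real" and K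
    using that measurable_cong_sets[OF sets refl] by auto
  have gint: "integrable K g" if "K = M \<or> K = N" for K
  proof -
    interpret prob_space K using that M N by auto
    show ?thesis
      using g ms[OF g(1) that] by (intro integrable_const_bound[where B = c]) auto
  qed
  show ?thesis
  proof (cases "m = 0")
    case True
    have "(\<integral>x. g x * indicator B (X x) \<partial>K) = 0" if K: "K = M \<or> K = N" for K
    proof -
      have "(\<integral>x. g x \<partial>K) = 0" using K True mN m_def by auto
      then have "AE x in K. g x = 0"
        using integral_nonneg_eq_0_iff_AE[OF gint[OF K]] g by auto
      then have "AE x in K. g x * indicator B (X x) = 0" by eventually_elim simp
      then show ?thesis by (rule integral_eq_zero_AE)
    qed
    then show ?thesis by simp
  next
    case False
    then have m: "m > 0" using \<open>0 \<le> m\<close> by simp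
    have D: "real_distribution (D K)"
      "\<And>t. char (D K) t = (\<integral>x. g x *\<^sub>R iexp (t * X x) \<partial>K) / m"
      "measure (D K) B = (\<integral>x. g x * indicator B (X x) \<partial>K) / m"
      if K: "K = M \<or> K = N" for K
    proof -
      note [measurable] = ms[OF g(1) K] ms[OF X K] B
      interpret prob_space K using K M N by auto
      have "emeasure (density K (\<lambda>x. g x / m)) (space K) = (\<integral>\<^sup>+x. ennreal (g x / m) \<partial>K)"
        by (subst emeasure_density) (auto intro!: nn_integral_cong)
      also have "\<dots> = ennreal (\<integral>x. g x / m \<partial>K)"
        using m g(2) gint[OF K] by (intro nn_integral_eq_integral) auto
      also have "(\<integral>x. g x / m \<partial>K) = 1" using K m mN m_def by auto
      finally interpret P: prob_space "density K (\<lambda>x. g x / m)"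
        by (intro prob_spaceI) simp
      have "prob_space (D K)" unfolding D_def by (rule P.prob_space_distr) simp
      then show rd: "real_distribution (D K)"
        by (simp add: D_def real_distribution_def real_distribution_axioms_def)
      show "char (D K) t = (\<integral>x. g x *\<^sub>R iexp (t * X x) \<partial>K) / m" for t
      proof -
        have "char (D K) t = (\<integral>x. (g x / m) *\<^sub>R iexp (t * X x) \<partial>K)"
          unfolding char_def D_def using m g(2)
          by (subst integral_distr, simp, simp, subst integral_density) auto
        also have "\<dots> = (\<integral>x. (g x *\<^sub>R iexp (t * X x)) / m \<partial>K)"
          by (simp add: scaleR_conv_of_real)
        finally show ?thesis by simp
      qed
      interpret D: prob_space "D K" by fact
      have "measure (D K) B = (\<integral>x. indicator B x \<partial>(D K))"
        by (simp add: D_def)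
      also have "\<dots> = (\<integral>x. (g x / m) *\<^sub>R indicator B (X x) \<partial>K)"
        unfolding D_def using m g(2)
        by (subst integral_distr, simp, simp, subst integral_density) auto
      finally show "measure (D K) B = (\<integral>x. g x * indicator B (X x) \<partial>K) / m"
        by simp
    qed
    have "D M = D N"
      using D eq by (intro Levy_uniqueness) (auto simp: fun_eq_iff)
    then show ?thesis using D(3) m by (metis div_by_0 divide_cancel_right less_irrefl)
  qed
qed

text \<open>Uniqueness of characteristic functions in several dimensions, reduced to one dimension one
  coordinate at a time. If the integrals of \<open>f(x) exp(i v\<bullet>x)\<close> agree for all \<open>v\<close>, they still agree
  after \<open>f\<close> is multiplied by the indicator of a Borel condition on one coordinate. Starting from
  \<open>f = 1\<close> this reaches all boxes, which determine the measure.\<close>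

lemma measure_eqI_iexp_inner:
  fixes P Q :: "(real^'n) measure"
  assumes P: "prob_space P" "sets P = sets borel" and Q: "prob_space Q" "sets Q = sets borel"
    and eq: "\<And>v. (\<integral>x. iexp (v \<bullet> x) \<partial>P) = (\<integral>x. iexp (v \<bullet> x) \<partial>Q)"
  shows "P = Q"
proof -
  interpret P: prob_space P by fact
  interpret Q: prob_space Q by fact
  have sets: "sets P = sets Q" using assms by simp
  have mP: "f \<in> borel_measurable P" and mQ: "f \<in> borel_measurable Q"
    if "f \<in> borel_measurable borel" for f :: "real^'n \<Rightarrow> 'z::topological_space"
    using that P(2) Q(2) measurable_cong_sets by blast+
  have cos_iexp: "complex_of_real (cos y) = (iexp y + iexp (- y)) / 2" for y
    using cos_exp_eq[of "complex_of_real y"] by (simp flip: cos_of_real)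
  have step: "(\<integral>x. (f x * indicator B (x $ k)) *\<^sub>R iexp (v \<bullet> x) \<partial>P)
      = (\<integral>x. (f x * indicator B (x $ k)) *\<^sub>R iexp (v \<bullet> x) \<partial>Q)"
    if f [measurable]: "f \<in> borel_measurable borel" and f01: "\<And>x. 0 \<le> f x" "\<And>x. f x \<le> 1"
      and B [measurable]: "B \<in> sets borel"
      and eq: "\<And>v. (\<integral>x. f x *\<^sub>R iexp (v \<bullet> x) \<partial>P) = (\<integral>x. f x *\<^sub>R iexp (v \<bullet> x) \<partial>Q)"
    for f :: "real^'n \<Rightarrow> real" and B k v
  proof -
    have int: "integrable K (\<lambda>x. f x *\<^sub>R iexp (v \<bullet> x))" if "K = P \<or> K = Q" for K v
    proof -
      interpret prob_space K using that P Q by auto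
      have "(\<lambda>x. f x *\<^sub>R iexp (v \<bullet> x)) \<in> borel_measurable K"
        using that by (auto intro!: mP mQ)
      then show ?thesis
        using f01 by (intro integrable_const_bound[where B = 1]) auto
    qed
    have plain: "(\<integral>x. f x * indicator B (x $ k) \<partial>P) = (\<integral>x. f x * indicator B (x $ k) \<partial>Q)"
    proof (rule weighted_char_unique[OF P(1) Q(1) sets _ f01 _ B])
      show "(\<integral>x. f x *\<^sub>R iexp (t * x $ k) \<partial>P) = (\<integral>x. f x *\<^sub>R iexp (t * x $ k) \<partial>Q)" for t
        using eq[of "t *\<^sub>R axis k 1"] by (simp add: inner_axis' )
    qed (auto intro!: mP)
    \<comment> \<open>A weight must be nonnegative, so the cosine is shifted
      by \<open>1\<close>; the phase \<open>- pi / 2\<close> will give the sine.\<close>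
    have cosw: "(\<integral>x. f x * indicator B (x $ k) * cos (v \<bullet> x + \<theta>) \<partial>P)
        = (\<integral>x. f x * indicator B (x $ k) * cos (v \<bullet> x + \<theta>) \<partial>Q)" for \<theta>
    proof -
      define g where "g x = f x * (1 + cos (v \<bullet> x + \<theta>))" for x
      have g [measurable]: "g \<in> borel_measurable borel" unfolding g_def by measurable
      have "1 + cos (v \<bullet> x + \<theta>) \<ge> 0" "1 + cos (v \<bullet> x + \<theta>) \<le> 2" for x
        using cos_ge_minus_one[of "v \<bullet> x + \<theta>"] cos_le_one[of "v \<bullet> x + \<theta>"] by linarith+
      then have g02: "0 \<le> g x" "g x \<le> 2" for x
        using f01[of x] mult_mono[of "f x" 1 "1 + cos (v \<bullet> x + \<theta>)" 2] by (auto simp: g_def)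
      have expand: "g x *\<^sub>R iexp (t * x $ k) = f x *\<^sub>R iexp ((t *\<^sub>R axis k 1) \<bullet> x)
          + iexp \<theta> / 2 * (f x *\<^sub>R iexp ((v + t *\<^sub>R axis k 1) \<bullet> x))
          + iexp (-\<theta>) / 2 * (f x *\<^sub>R iexp ((- v + t *\<^sub>R axis k 1) \<bullet> x))" for x t
      proof -
        have "complex_of_real (cos (v \<bullet> x + \<theta>)) = (iexp (v \<bullet> x + \<theta>) + iexp (-(v \<bullet> x + \<theta>))) / 2"
          using cos_iexp .
        then have "g x *\<^sub>R iexp (t * x $ k)
            = f x * (1 + (iexp (v \<bullet> x + \<theta>) + iexp (-(v \<bullet> x + \<theta>))) / 2) * iexp (t * x $ k)"
          by (simp add: g_def scaleR_conv_of_real)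
        also have "\<dots> = f x *\<^sub>R iexp ((t *\<^sub>R axis k 1) \<bullet> x)
          + iexp \<theta> / 2 * (f x *\<^sub>R iexp ((v + t *\<^sub>R axis k 1) \<bullet> x))
          + iexp (-\<theta>) / 2 * (f x *\<^sub>R iexp ((- v + t *\<^sub>R axis k 1) \<bullet> x))"
        proof -
          have "(t *\<^sub>R axis k 1) \<bullet> x = t * x $ k" by (simp add: inner_axis')
          moreover have "iexp (a + b) = iexp a * iexp b" for a b :: real
            by (simp add: distrib_left exp_add)
          ultimately show ?thesis
            by (simp only: inner_add_left inner_minus_left minus_add_distrib scaleR_conv_of_real)
              (simp add: field_simps)
        qed
        finally show ?thesis .
      qed
      have "(\<integral>x. g x *\<^sub>R iexp (t * x $ k) \<partial>K) = (\<integral>x. f x *\<^sub>R iexp ((t *\<^sub>R axis k 1) \<bullet> x) \<partial>K)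
          + iexp \<theta> / 2 * (\<integral>x. f x *\<^sub>R iexp ((v + t *\<^sub>R axis k 1) \<bullet> x) \<partial>K)
          + iexp (-\<theta>) / 2 * (\<integral>x. f x *\<^sub>R iexp ((- v + t *\<^sub>R axis k 1) \<bullet> x) \<partial>K)"
        if K: "K = P \<or> K = Q" for K t
        unfolding expand
        by (simp only: Bochner_Integration.integral_add Bochner_Integration.integral_mult_right
            Bochner_Integration.integrable_add Bochner_Integration.integrable_mult_right int[OF K])
      then have "(\<integral>x. g x *\<^sub>R iexp (t * x $ k) \<partial>P) = (\<integral>x. g x *\<^sub>R iexp (t * x $ k) \<partial>Q)" for t
        by (simp only: eq simp_thms)
      then have gB: "(\<integral>x. g x * indicator B (x $ k) \<partial>P) = (\<integral>x. g x * indicator B (x $ k) \<partial>Q)"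
        by (intro weighted_char_unique[OF P(1) Q(1) sets _ g02 _ B]) (auto intro!: mP)
      have "(\<integral>x. f x * indicator B (x $ k) * cos (v \<bullet> x + \<theta>) \<partial>K)
          = (\<integral>x. g x * indicator B (x $ k) \<partial>K) - (\<integral>x. f x * indicator B (x $ k) \<partial>K)"
        if K: "K = P \<or> K = Q" for K
      proof -
        interpret prob_space K using K P Q by auto
        have "integrable K (\<lambda>x. g x * indicator B (x $ k))"
          using K g02 by (intro integrable_const_bound[where B = 2])
            (auto intro!: mP mQ simp: indicator_def)
        moreover have "integrable K (\<lambda>x. f x * indicator B (x $ k))"
          using K f01 by (intro integrable_const_bound[where B = 1])
            (auto intro!: mP mQ simp: indicator_def)
        ultimately show ?thesis
          by (subst Bochner_Integration.integral_diff[symmetric]) (auto simp: g_def algebra_simps)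
      qed
      then show ?thesis using gB plain by simp
    qed
    have "(\<integral>x. (f x * indicator B (x $ k)) *\<^sub>R iexp (v \<bullet> x) \<partial>K)
        = of_real (\<integral>x. f x * indicator B (x $ k) * cos (v \<bullet> x + 0) \<partial>K)
          + \<i> * of_real (\<integral>x. f x * indicator B (x $ k) * cos (v \<bullet> x + (- pi / 2)) \<partial>K)"
      if K: "K = P \<or> K = Q" for K
    proof -
      interpret prob_space K using K P Q by auto
      have i: "integrable K (\<lambda>x. f x * indicator B (x $ k) * cos (v \<bullet> x + \<theta>))" for \<theta>
      proof (rule integrable_const_bound[where B = 1])
        show "AE x in K. norm (f x * indicator B (x $ k) * cos (v \<bullet> x + \<theta>)) \<le> 1"
        proof (rule AE_I2)
          fix x
          have "\<bar>f x\<bar> * \<bar>cos (v \<bullet> x + \<theta>)\<bar> \<le> 1 * 1" using f01[of x] by (intro mult_mono) auto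
          then show "norm (f x * indicator B (x $ k) * cos (v \<bullet> x + \<theta>)) \<le> 1"
            by (simp add: indicator_def abs_mult)
        qed
        show "(\<lambda>x. f x * indicator B (x $ k) * cos (v \<bullet> x + \<theta>)) \<in> borel_measurable K"
          using K by (auto intro!: mP mQ)
      qed
      have "(f x * indicator B (x $ k)) *\<^sub>R iexp (v \<bullet> x)
          = complex_of_real (f x * indicator B (x $ k) * cos (v \<bullet> x + 0))
            + \<i> * complex_of_real (f x * indicator B (x $ k) * cos (v \<bullet> x + (- pi / 2)))" for x
        by (simp add: complex_eq_iff Re_exp Im_exp cos_diff)
      then show ?thesis using i
        by (simp only: Bochner_Integration.integral_add Bochner_Integration.integral_mult_right integrable_of_real
            Bochner_Integration.integrable_add Bochner_Integration.integrable_mult_right integral_complex_of_real)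
    qed
    then show ?thesis by (simp only: cosw simp_thms)
  qed
  have rect: "(\<integral>x. (\<Prod>k\<in>J. indicator (S k) (x $ k)) *\<^sub>R iexp (v \<bullet> x) \<partial>P)
      = (\<integral>x. (\<Prod>k\<in>J. indicator (S k) (x $ k)) *\<^sub>R iexp (v \<bullet> x) \<partial>Q)"
    if "\<And>k. S k \<in> sets borel" for S :: "'n \<Rightarrow> real set" and J v
    using finite[of J]
  proof (induction J arbitrary: v)
    case empty
    then show ?case using eq by simp
  next
    case (insert k J)
    have "(\<integral>x. ((\<Prod>k\<in>J. indicator (S k) (x $ k)) * indicator (S k) (x $ k)) *\<^sub>R iexp (v \<bullet> x) \<partial>P)
      = (\<integral>x. ((\<Prod>k\<in>J. indicator (S k) (x $ k)) * indicator (S k) (x $ k)) *\<^sub>R iexp (v \<bullet> x) \<partial>Q)"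
      using insert.IH that
      by (intro step) (auto intro!: prod_nonneg prod_le_1 borel_measurable_prod
          measurable_compose[OF borel_measurable_vec_nth borel_measurable_indicator] that)
    then show ?case using insert.hyps by (simp add: mult.commute)
  qed
  have box: "emeasure P (box a b) = emeasure Q (box a b)" for a b :: "real^'n"
  proof -
    have ind: "(\<Prod>k\<in>UNIV. indicator {a $ k<..<b $ k} (x $ k)) = (indicator (box a b) x :: real)"
      for x
      by (auto simp: mem_box_cart indicator_def prod_zero_iff)
    have "complex_of_real (measure P (box a b)) = complex_of_real (measure Q (box a b))"
    proof -
      have "(\<integral>x. (\<Prod>k\<in>UNIV. indicator {a $ k<..<b $ k} (x $ k)) *\<^sub>R iexp (0 \<bullet> x) \<partial>P)
          = (\<integral>x. (\<Prod>k\<in>UNIV. indicator {a $ k<..<b $ k} (x $ k)) *\<^sub>R iexp (0 \<bullet> x) \<partial>Q)"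
        by (rule rect) simp
      then show ?thesis using P Q by (simp add: ind scaleR_conv_of_real)
    qed
    then show ?thesis by (simp add: P.emeasure_eq_measure Q.emeasure_eq_measure)
  qed
  show ?thesis
  proof (rule measure_eqI_generator_eq)
    let ?E = "range (\<lambda>(a, b). box a b :: (real^'n) set)"
    show "Int_stable ?E" by (auto simp: Int_stable_def box_Int_box)
    show "?E \<subseteq> Pow UNIV" "range (\<lambda>n. box (- (real n *\<^sub>R One)) (real n *\<^sub>R One)) \<subseteq> ?E"
      by auto
    show "sets P = sigma_sets UNIV ?E" "sets Q = sigma_sets UNIV ?E"
      unfolding P(2) Q(2) by (simp_all add: borel_eq_box)
    show "(\<Union>n. box (- (real n *\<^sub>R One)) (real n *\<^sub>R One) :: (real^'n) set) = UNIV"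
      by (rule UN_box_eq_UNIV)
  qed (auto simp: box Q.emeasure_eq_measure)
qed

lemma char_normal_zero_mean:
  assumes s: "s > 0"
  shows "(\<integral>y. iexp y \<partial>(density lborel (\<lambda>y. ennreal (normal_density 0 s y)))) = complex_of_real (exp (- s\<^sup>2 / 2))"
proof -
  interpret N: prob_space std_normal_distribution by (intro prob_space_normal_density) simp
  have "distr std_normal_distribution lborel (\<lambda>x. x) = std_normal_distribution"
    by (intro distr_id2) simp
  then have "distributed std_normal_distribution lborel (\<lambda>x. x) std_normal_density"
    by (simp add: distributed_def)
  from N.normal_density_affine[OF this _ , of s 0] s
  have "distributed std_normal_distribution lborel (\<lambda>x. s * x) (normal_density 0 s)" by simp
  then have eq: "distr std_normal_distribution lborel (\<lambda>x. s * x) = density lborel (\<lambda>y. ennreal (normal_density 0 s y))"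
    by (simp add: distributed_def)
  have "(\<integral>y. iexp y \<partial>(density lborel (\<lambda>y. ennreal (normal_density 0 s y))))
      = (\<integral>x. iexp (s * x) \<partial>std_normal_distribution)"
    unfolding eq[symmetric] by (subst integral_distr) simp_all
  also have "\<dots> = char std_normal_distribution s" by (simp add: char_def)
  finally show ?thesis by (simp add: char_std_normal_distribution)
qed

text \<open>What the description
  by one-dimensional marginals yields for later use; the last part says that
  the characteristic function depends on the second moments only.\<close>

lemma zero_mean_normal_marginal:
  fixes P :: "(real^'n) measure"
  assumes "zero_mean_normal P"
  shows "integrable P (\<lambda>x. v \<bullet> x)" "(\<integral>x. v \<bullet> x \<partial>P) = 0"
    "integrable P (\<lambda>x. (v \<bullet> x)\<^sup>2)"
    "(\<integral>x. iexp (v \<bullet> x) \<partial>P) = complex_of_real (exp (- (\<integral>x. (v \<bullet> x)\<^sup>2 \<partial>P) / 2))"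
proof -
  have sP [measurable_cong]: "sets P = sets borel" and pP: "prob_space P" using assms
    by (auto simp: zero_mean_normal_def)
  interpret prob_space P by fact
  have v [measurable]: "(\<lambda>x. v \<bullet> x) \<in> borel_measurable P" by measurable
  obtain s where s: "s \<ge> 0" and D: "distr P borel (\<lambda>x. v \<bullet> x) =
        (if s = 0 then return borel 0
         else density lborel (\<lambda>y. ennreal (normal_density 0 s y)))"
    using assms by (auto simp: zero_mean_normal_def)
  note i = integrable_distr_eq[OF v] integral_distr[OF v]
  have "integrable P (\<lambda>x. v \<bullet> x) \<and> (\<integral>x. v \<bullet> x \<partial>P) = 0 \<and>
      integrable P (\<lambda>x. (v \<bullet> x)\<^sup>2) \<and> (\<integral>x. (v \<bullet> x)\<^sup>2 \<partial>P) = s\<^sup>2 \<and>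
      (\<integral>x. iexp (v \<bullet> x) \<partial>P) = complex_of_real (exp (- s\<^sup>2 / 2))"
  proof (cases "s = 0")
    case True
    interpret R: prob_space "return borel (0::real)" by (intro prob_space_return) simp
    have "integrable (return borel 0) f \<and> (\<integral>x. f x \<partial>return borel 0) = f 0"
      if "f \<in> borel_measurable borel" for f :: "real \<Rightarrow> 'b::{banach, second_countable_topology}"
    proof
      have "AE x in return borel 0. f x = f 0" using that by (subst AE_return) auto
      then show "integrable (return borel 0) f" using that
        by (subst integrable_cong_AE[where g = "\<lambda>_. f 0"]) auto
    qed (use that in \<open>simp add: integral_return\<close>)
    from this[of "\<lambda>x. x"] this[of "\<lambda>x. x\<^sup>2"] this[of "\<lambda>x. iexp x"]
    show ?thesis
      using i(1)[of "\<lambda>x. x"] i(2)[of "\<lambda>x. x"] i(1)[of "\<lambda>x. x\<^sup>2"] i(2)[of "\<lambda>x. x\<^sup>2"]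
        i(2)[of "\<lambda>x. iexp x"] D True by simp
  next
    case False
    then have s: "s > 0" using s by simp
    let ?N = "density lborel (\<lambda>y. ennreal (normal_density 0 s y))"
    have N1: "integrable ?N (\<lambda>x. x)" "(\<integral>x. x \<partial>?N) = 0"
      using integrable_normal_moment_nz_1[OF s, of 0] integral_normal_moment_nz_1[OF s, of 0]
      by (simp_all add: integrable_density integral_density)
    have N2: "integrable ?N (\<lambda>x. x\<^sup>2)" "(\<integral>x. x\<^sup>2 \<partial>?N) = s\<^sup>2"
      using integrable_normal_moment[OF s, of 0 2] integral_normal_moment_even[OF s, of 0 1]
      by (simp_all add: integrable_density integral_density eval_nat_numeral)
    have D': "distr P borel (\<lambda>x. v \<bullet> x) = ?N" using D False by simp
    note int = i(1)[unfolded D', THEN iffD1, rotated] and eq = i(2)[unfolded D', symmetric, THEN trans, rotated]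
    show ?thesis
      using int[OF N1(1)] eq[OF N1(2)] int[OF N2(1)] eq[OF N2(2)] eq[OF char_normal_zero_mean[OF s]]
      by (intro conjI) simp_all
  qed
  then show "integrable P (\<lambda>x. v \<bullet> x)" "(\<integral>x. v \<bullet> x \<partial>P) = 0"
    "integrable P (\<lambda>x. (v \<bullet> x)\<^sup>2)"
    "(\<integral>x. iexp (v \<bullet> x) \<partial>P) = complex_of_real (exp (- (\<integral>x. (v \<bullet> x)\<^sup>2 \<partial>P) / 2))" by simp_all
qed

lemma second_moment_eq_cross_moment: "second_moment P = cross_moment P (\<lambda>x. x) (\<lambda>x. x)"
  by (simp add: second_moment_def cross_moment_def)

lemma zero_mean_normal_L2:
  fixes P :: "(real^'n) measure"
  assumes "zero_mean_normal P"
  shows "(\<lambda>x. x) \<in> L2 P"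
proof -
  have [measurable_cong]: "sets P = sets borel" using assms by (auto simp: zero_mean_normal_def)
  have "integrable P (\<lambda>x. x $ i * x $ i)" for i
    using zero_mean_normal_marginal(3)[OF assms, of "axis i 1"]
    by (simp add: inner_axis' power2_eq_square)
  then have "integrable P (\<lambda>x. (norm x)\<^sup>2)" by (simp add: norm_sq_eq_sum)
  moreover have "(\<lambda>x. x) \<in> borel_measurable P" by measurable
  ultimately show ?thesis by (simp add: L2_def)
qed

definition std_gaussian :: "(real^'n) measure" where
  "std_gaussian = distr (\<Pi>\<^sub>M i\<in>UNIV. std_normal_distribution) borel (\<lambda>f. \<chi> i. f i)"

lemma measurable_vec_lambda_PiM [measurable]:
  "(\<lambda>f. \<chi> i. f i) \<in> borel_measurable (\<Pi>\<^sub>M i\<in>(UNIV :: 'n::finite set). std_normal_distribution)"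
  by (simp add: borel_measurable_vec_iff)

lemma sets_std_gaussian [simp, measurable_cong]: "sets std_gaussian = sets borel"
  by (simp add: std_gaussian_def)

lemma prob_space_std_gaussian: "prob_space (std_gaussian :: (real^'n) measure)"
proof -
  interpret prob_space "\<Pi>\<^sub>M i\<in>(UNIV :: 'n set). std_normal_distribution"
    by (intro prob_space_PiM prob_space_normal_density) simp
  show ?thesis unfolding std_gaussian_def by (rule prob_space_distr) simp
qed

text \<open>The independence of the coordinates, from which the characteristic function and the moments
  both follow.\<close>

lemma integral_prod_std_gaussian:
  fixes f :: "'n::finite \<Rightarrow> real \<Rightarrow> 'b::{real_normed_field,banach,second_countable_topology}"
  assumes f: "\<And>i. integrable std_normal_distribution (f i)"
  shows "integrable std_gaussian (\<lambda>x :: real^'n. \<Prod>i\<in>UNIV. f i (x $ i))"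
    "(\<integral>x. (\<Prod>i\<in>UNIV. f i (x $ i)) \<partial>(std_gaussian :: (real^'n) measure)) = (\<Prod>i\<in>UNIV. \<integral>y. f i y \<partial>std_normal_distribution)"
proof -
  interpret N: prob_space std_normal_distribution by (intro prob_space_normal_density) simp
  interpret product_sigma_finite "\<lambda>_::'n. std_normal_distribution" ..
  have m: "f i \<in> borel_measurable borel" for i
    using f[of i] borel_measurable_integrable by fastforce
  have m': "(\<lambda>x :: real^'n. \<Prod>i\<in>UNIV. f i (x $ i)) \<in> borel_measurable borel"
    by (intro borel_measurable_prod measurable_compose[OF borel_measurable_vec_nth m])
  show "integrable std_gaussian (\<lambda>x :: real^'n. \<Prod>i\<in>UNIV. f i (x $ i))"
    using f unfolding std_gaussian_def
    by (subst integrable_distr_eq[OF measurable_vec_lambda_PiM m'])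
       (auto intro!: product_integrable_prod)
  show "(\<integral>x. (\<Prod>i\<in>UNIV. f i (x $ i)) \<partial>(std_gaussian :: (real^'n) measure)) = (\<Prod>i\<in>UNIV. \<integral>y. f i y \<partial>std_normal_distribution)"
    using f unfolding std_gaussian_def
    by (subst integral_distr[OF measurable_vec_lambda_PiM m'])
       (auto intro!: product_integral_prod)
qed

lemma char_std_gaussian:
  "(\<integral>x. iexp (v \<bullet> x) \<partial>(std_gaussian :: (real^'n) measure)) = complex_of_real (exp (- (norm v)\<^sup>2 / 2))"
proof -
  interpret N: prob_space std_normal_distribution by (intro prob_space_normal_density) simp
  have "(\<integral>x. iexp (v \<bullet> x) \<partial>(std_gaussian :: (real^'n) measure))
      = (\<integral>x. (\<Prod>i\<in>UNIV. iexp (v $ i * x $ i)) \<partial>(std_gaussian :: (real^'n) measure))"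
    by (simp add: inner_vec_def sum_distrib_left flip: exp_sum)
  also have "\<dots> = (\<Prod>i\<in>UNIV. \<integral>y. iexp (v $ i * y) \<partial>std_normal_distribution)"
    by (intro integral_prod_std_gaussian(2) N.integrable_iexp) auto
  also have "\<dots> = (\<Prod>i\<in>UNIV. complex_of_real (exp (- (v $ i)\<^sup>2 / 2)))"
    using char_std_normal_distribution by (simp add: char_def fun_eq_iff)
  also have "\<dots> = complex_of_real (exp (\<Sum>i\<in>UNIV. - (v $ i)\<^sup>2 / 2))"
    by (simp only: of_real_prod exp_sum finite)
  also have "(\<Sum>i\<in>UNIV. - (v $ i)\<^sup>2 / 2) = - (norm v)\<^sup>2 / 2"
    by (subst norm_sq_eq_sum, simp add: power2_eq_square sum_negf flip: sum_divide_distrib)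
  finally show ?thesis .
qed

lemma std_gaussian_moments:
  "integrable std_gaussian (\<lambda>x :: real^'n. x $ i)" "(\<integral>x. x $ i \<partial>(std_gaussian :: (real^'n) measure)) = 0"
  "integrable std_gaussian (\<lambda>x :: real^'n. x $ i * x $ j)"
  "(\<integral>x. x $ i * x $ j \<partial>(std_gaussian :: (real^'n) measure)) = (if i = j then 1 else 0)"
proof -
  interpret N: prob_space std_normal_distribution by (intro prob_space_normal_density) simp
  have 1: "integrable std_normal_distribution (\<lambda>y. y)" "(\<integral>y. y \<partial>std_normal_distribution) = 0"
    using integrable_std_normal_moment[of 1] integral_std_normal_moment_odd[of 0]
    by (simp_all add: integrable_density integral_density)
  have 2: "integrable std_normal_distribution (\<lambda>y. y * y)" "(\<integral>y. y * y \<partial>std_normal_distribution) = 1"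
    using integrable_std_normal_moment[of 2] integral_std_normal_moment_even[of 1]
    by (simp_all add: integrable_density integral_density power2_eq_square)
  \<comment> \<open>Monomials are written as products over all coordinates, with factor \<open>1\<close> in the others.\<close>
  define f where "f k y = (if k = i then y else 1 :: real)" for k y
  have f: "integrable std_normal_distribution (f k)" for k
    using 1 by (cases "k = i") (simp_all add: f_def[abs_def])
  have fx: "(\<Prod>k\<in>UNIV. f k (x $ k)) = x $ i" for x :: "real^'n" by (simp add: f_def)
  show "integrable std_gaussian (\<lambda>x :: real^'n. x $ i)"
    using integral_prod_std_gaussian(1)[of f, OF f] by (simp add: fx)
  have "(\<integral>x. x $ i \<partial>(std_gaussian :: (real^'n) measure)) = (\<Prod>k\<in>UNIV. \<integral>y. f k y \<partial>std_normal_distribution)"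
    using integral_prod_std_gaussian(2)[of f, OF f] by (simp add: fx)
  also have "\<dots> = 0" using 1 by (intro prod_zero) (auto simp: f_def intro!: exI[of _ i])
  finally show "(\<integral>x. x $ i \<partial>(std_gaussian :: (real^'n) measure)) = 0" .
  define g where "g k y = (if k = i then y else 1 :: real) * (if k = j then y else 1)" for k y
  have g: "integrable std_normal_distribution (g k)" for k using 1 2
    by (cases "k = i"; cases "k = j") (simp_all add: g_def[abs_def])
  have gx: "(\<Prod>k\<in>UNIV. g k (x $ k)) = x $ i * x $ j" for x :: "real^'n"
    by (simp add: g_def prod.distrib)
  show "integrable std_gaussian (\<lambda>x :: real^'n. x $ i * x $ j)"
    using integral_prod_std_gaussian(1)[of g, OF g] by (simp add: gx)
  have "(\<integral>x. x $ i * x $ j \<partial>(std_gaussian :: (real^'n) measure)) = (\<Prod>k\<in>UNIV. \<integral>y. g k y \<partial>std_normal_distribution)"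
    using integral_prod_std_gaussian(2)[of g, OF g] by (simp add: gx)
  also have "\<dots> = (if i = j then 1 else 0)"
  proof (cases "i = j")
    case True
    then have "(\<integral>y. g k y \<partial>std_normal_distribution) = 1" for k
      using 2 N.prob_space by (cases "k = i") (auto simp: g_def)
    then show ?thesis using True by simp
  next
    case False
    then have "(\<integral>y. g i y \<partial>std_normal_distribution) = 0" using 1 by (simp add: g_def)
    then show ?thesis using False by (auto intro!: prod_zero)
  qed
  finally show "(\<integral>x. x $ i * x $ j \<partial>(std_gaussian :: (real^'n) measure)) = (if i = j then 1 else 0)" .
qed

lemma std_gaussian_L2: "(\<lambda>x :: real^'n. x) \<in> L2 std_gaussian"
proof -
  have "(\<lambda>x :: real^'n. x) \<in> borel_measurable std_gaussian" by measurable
  then show ?thesis by (simp add: L2_def norm_sq_eq_sum std_gaussian_moments)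
qed

lemma cross_moment_std_gaussian: "cross_moment std_gaussian (\<lambda>x :: real^'n. x) (\<lambda>x. x) = mat 1"
  by (simp add: cross_moment_def mat_def std_gaussian_moments)

lemma integral_std_gaussian: "(\<integral>x. x \<partial>(std_gaussian :: (real^'n) measure)) = 0"
proof -
  have "integrable std_gaussian (\<lambda>x :: real^'n. x)"
    by (rule prob_space.L2_imp_integrable[OF prob_space_std_gaussian std_gaussian_L2])
  then have "(\<integral>x. x \<partial>(std_gaussian :: (real^'n) measure)) \<bullet> axis i 1 = (\<integral>x. x \<bullet> axis i 1 \<partial>(std_gaussian :: (real^'n) measure))" for i
    by (subst integral_inner_left) auto
  then show ?thesis by (simp add: vec_eq_iff inner_axis std_gaussian_moments)
qed

text \<open>Both measures have the characteristic function \<open>exp (- v \<bullet> (X X\<^sup>T v) / 2)\<close>.\<close>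

lemma distr_std_gaussian_eq:
  fixes P :: "(real^'m) measure" and X :: "real^'n^'m"
  assumes P: "zero_mean_normal P" and X: "X ** transpose X = second_moment P"
  shows "distr std_gaussian borel ((*v) X) = P"
proof (rule measure_eqI_iexp_inner)
  interpret prob_space "std_gaussian :: (real^'n) measure" by (rule prob_space_std_gaussian)
  show "prob_space (distr std_gaussian borel ((*v) X))" by (rule prob_space_distr) simp
  show "prob_space P" "sets P = sets borel" using P by (auto simp: zero_mean_normal_def)
  fix v
  have "(\<integral>x. iexp (v \<bullet> x) \<partial>distr std_gaussian borel ((*v) X)) = (\<integral>x. iexp ((transpose X *v v) \<bullet> x) \<partial>(std_gaussian :: (real^'n) measure))"
    by (subst integral_distr) (auto simp: dot_lmul_matrix)
  also have "\<dots> = complex_of_real (exp (- (norm (transpose X *v v))\<^sup>2 / 2))"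
    by (rule char_std_gaussian)
  also have "(norm (transpose X *v v))\<^sup>2 = v \<bullet> (second_moment P *v v)"
    unfolding X[symmetric]
      by (simp add: power2_norm_eq_inner dot_lmul_matrix flip: matrix_vector_mul_assoc)
  also have "\<dots> = (\<integral>x. (v \<bullet> x)\<^sup>2 \<partial>P)"
    by (simp add: integral_inner_sq[OF zero_mean_normal_L2[OF P]] second_moment_eq_cross_moment)
  also have "complex_of_real (exp (- \<dots> / 2)) = (\<integral>x. iexp (v \<bullet> x) \<partial>P)"
    by (rule zero_mean_normal_marginal(4)[OF P, symmetric])
  finally show "(\<integral>x. iexp (v \<bullet> x) \<partial>distr std_gaussian borel ((*v) X)) = (\<integral>x. iexp (v \<bullet> x) \<partial>P)" .
qed simp

section \<open>Positive semidefinite matrices\<close>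

text \<open>The quadratic \<open>t \<mapsto> (v + t w)\<^sup>T S (v + t w)\<close> is nonnegative, so its discriminant is not positive.\<close>

lemma psd_Cauchy_Schwarz:
  fixes S :: "real^'n^'n"
  assumes "psd S"
  shows "(v \<bullet> (S *v w))\<^sup>2 \<le> (v \<bullet> (S *v v)) * (w \<bullet> (S *v w))"
proof -
  have sym: "w \<bullet> (S *v v) = v \<bullet> (S *v w)"
    using assms unfolding psd_def symmetric_matrix_def
    by (metis dot_lmul_matrix inner_commute transpose_matrix_vector)
  define a b c where "a = v \<bullet> (S *v v)" and "b = v \<bullet> (S *v w)" and "c = w \<bullet> (S *v w)"
  have pos: "0 \<le> a + 2 * t * b + t\<^sup>2 * c" for t
  proof -
    have "0 \<le> (v + t *\<^sub>R w) \<bullet> (S *v (v + t *\<^sub>R w))" using assms by (auto simp: psd_def)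
    also have "\<dots> = a + 2 * t * b + t\<^sup>2 * c"
      by (simp add: a_def b_def c_def matrix_vector_right_distrib matrix_vector_mult_scaleR
          inner_add_left inner_add_right sym power2_eq_square algebra_simps)
    finally show ?thesis .
  qed
  have "c \<ge> 0" using assms by (auto simp: c_def psd_def)
  have "b\<^sup>2 \<le> a * c"
  proof (cases "c = 0")
    case True
    have "b = 0"
    proof (rule ccontr)
      assume "b \<noteq> 0"
      then have "2 * (- (a + 1) / (2 * b)) * b = - (a + 1)" by simp
      then show False using pos[of "- (a + 1) / (2 * b)"] True by simp
    qed
    then show ?thesis using True by simp
  next
    case False
    then have "c > 0" using \<open>c \<ge> 0\<close> by simp
    then show ?thesis using pos[of "- b / c"] by (simp add: field_simps power2_eq_square)
  qed
  then show ?thesis by (simp add: a_def b_def c_def)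
qed

lemma inner_axis_matrix: "axis i 1 \<bullet> (S *v axis j 1) = (S :: real^'n^'m) $ i $ j"
  by (simp add: inner_axis' matrix_vector_mult_basis column_def)

text \<open>Cholesky elimination of one index at a time. If \<open>S $ k $ k = 0\<close>, row and column \<open>k\<close> vanish by
  Cauchy-Schwarz; otherwise subtracting a rank-one matrix clears them and the remainder is again
  positive semidefinite. The set \<open>J\<close> of remaining indices plays the role of a shrinking dimension;
  that columns outside \<open>J\<close> vanish leaves column \<open>k\<close> free for the new vector.\<close>

lemma psd_eq_mult_transpose_supported:
  fixes S :: "real^'n^'n"
  assumes "finite J" "psd S" "\<And>i j. i \<notin> J \<or> j \<notin> J \<Longrightarrow> S $ i $ j = 0"
  shows "\<exists>L :: real^'n^'n. S = L ** transpose L \<and> (\<forall>i k. k \<notin> J \<longrightarrow> L $ i $ k = 0)"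
  using assms
proof (induction J arbitrary: S)
  case empty
  then have "S = 0" by (simp add: vec_eq_iff)
  then show ?case by (intro exI[of _ 0]) (simp add: matrix_matrix_mult_def vec_eq_iff)
next
  case (insert k J)
  define c where "c = S $ k $ k"
  have sym: "S $ i $ j = S $ j $ i" for i j
  proof -
    have "transpose S $ i $ j = S $ i $ j"
      using insert.prems(1) by (simp add: psd_def symmetric_matrix_def)
    then show ?thesis by (simp add: transpose_def)
  qed
  have "0 \<le> axis k 1 \<bullet> (S *v axis k 1)" using insert.prems(1) by (simp add: psd_def)
  then have "c \<ge> 0" by (simp add: inner_axis_matrix c_def)
  show ?case
  proof (cases "c = 0")
    case True
    have "S $ i $ k = 0" for i
      using psd_Cauchy_Schwarz[OF insert.prems(1), of "axis i 1" "axis k 1"] True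
      by (simp add: inner_axis_matrix c_def)
    then have "S $ i $ j = 0" if "i \<notin> J \<or> j \<notin> J" for i j
      using insert.prems(2)[of i j] that sym by (metis insertE)
    then show ?thesis using insert.IH[OF insert.prems(1)] by fastforce
  next
    case False
    then have c: "c > 0" using \<open>c \<ge> 0\<close> by simp
    define S' where "S' = (\<chi> i j. S $ i $ j - S $ i $ k * S $ j $ k / c)"
    have "psd S'" unfolding psd_def symmetric_matrix_def
    proof (intro conjI allI)
      show "transpose S' = S'" using sym by (simp add: S'_def transpose_def vec_eq_iff mult.commute)
      fix v
      have "S' *v v = S *v v - ((v \<bullet> (S *v axis k 1)) / c) *\<^sub>R (S *v axis k 1)"
        by (simp add: S'_def vec_eq_iff matrix_vector_mult_def matrix_vector_mult_basis column_def
            inner_vec_def sum_subtractf sum_divide_distrib sum_distrib_left sum_distrib_right axis_def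
            if_distrib cong: if_cong)
          (simp add: algebra_simps flip: sum.distrib)
      then have "v \<bullet> (S' *v v) = v \<bullet> (S *v v) - (v \<bullet> (S *v axis k 1))\<^sup>2 / c"
        by (simp add: inner_diff_right power2_eq_square)
      moreover have "(v \<bullet> (S *v axis k 1))\<^sup>2 \<le> (v \<bullet> (S *v v)) * c"
        using psd_Cauchy_Schwarz[OF insert.prems(1), of v "axis k 1"]
        by (simp add: inner_axis_matrix c_def)
      then have "(v \<bullet> (S *v axis k 1))\<^sup>2 / c \<le> v \<bullet> (S *v v)" using c by (simp add: field_simps)
      ultimately show "0 \<le> v \<bullet> (S' *v v)" by simp
    qed
    moreover have "S' $ i $ j = 0" if "i \<notin> J \<or> j \<notin> J" for i j
    proof (cases "i = k \<or> j = k")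
      case True
      then show ?thesis using c sym by (auto simp: S'_def c_def)
    next
      case False
      then show ?thesis using that insert.prems(2) by (auto simp: S'_def)
    qed
    ultimately obtain L' where L': "S' = L' ** transpose L'" "\<And>i l. l \<notin> J \<Longrightarrow> L' $ i $ l = 0"
      using insert.IH by blast
    define L where "L = (\<chi> i l. if l = k then S $ i $ k / sqrt c else L' $ i $ l)"
    have "(L ** transpose L) $ i $ j = S $ i $ j" for i j
    proof -
      have "(L ** transpose L) $ i $ j = (\<Sum>l\<in>UNIV. L $ i $ l * L $ j $ l)"
        by (simp add: matrix_matrix_mult_def transpose_def)
      also have "\<dots> = L $ i $ k * L $ j $ k + (\<Sum>l\<in>UNIV - {k}. L $ i $ l * L $ j $ l)"
        by (rule sum.remove) auto
      also have "(\<Sum>l\<in>UNIV - {k}. L $ i $ l * L $ j $ l) = (\<Sum>l\<in>UNIV - {k}. L' $ i $ l * L' $ j $ l)"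
        by (intro sum.cong) (auto simp: L_def)
      also have "\<dots> = (\<Sum>l\<in>UNIV. L' $ i $ l * L' $ j $ l)"
        using L'(2)[OF insert.hyps(2)] by (subst (2) sum.remove[of _ k]) auto
      also have "\<dots> = S' $ i $ j"
        unfolding L'(1) by (simp add: matrix_matrix_mult_def transpose_def)
      also have "L $ i $ k * L $ j $ k = S $ i $ k * S $ j $ k / c"
        using c by (simp add: L_def)
      finally show ?thesis by (simp add: S'_def)
    qed
    then have "S = L ** transpose L" by (simp add: vec_eq_iff)
    moreover have "L $ i $ l = 0" if "l \<notin> insert k J" for i l
      using that L'(2) by (auto simp: L_def)
    ultimately show ?thesis by blast
  qed
qed

lemma psd_eq_mult_transpose:
  fixes S :: "real^'n^'n"
  assumes "psd S"
  obtains L :: "real^'n^'n" where "S = L ** transpose L"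
  using psd_eq_mult_transpose_supported[OF _ assms, of UNIV] by auto

lemma orthogonal_transformation_reflection:
  fixes n :: "'a::euclidean_space"
  shows "orthogonal_transformation (\<lambda>z. z - (2 * (z \<bullet> n) / (n \<bullet> n)) *\<^sub>R n)"
  unfolding orthogonal_transformation
proof (intro conjI allI)
  show "linear (\<lambda>z. z - (2 * (z \<bullet> n) / (n \<bullet> n)) *\<^sub>R n)"
    by (rule linearI) (simp_all add: inner_add_left algebra_simps add_divide_distrib scaleR_add_left)
  show "norm (z - (2 * (z \<bullet> n) / (n \<bullet> n)) *\<^sub>R n) = norm z" for z
  proof (cases "n = 0")
    case False
    then have "(norm (z - (2 * (z \<bullet> n) / (n \<bullet> n)) *\<^sub>R n))\<^sup>2 = (norm z)\<^sup>2"
      unfolding power2_norm_eq_inner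
      by (simp add: inner_diff_left inner_diff_right inner_commute field_simps power2_eq_square)
    then show ?thesis by (simp add: power2_eq_iff_nonneg)
  qed simp
qed

text \<open>Families with equal Gram matrices are congruent. Having matched all but one vector, reflect in
  the hyperplane that exchanges the image \<open>f (x k)\<close> with its target \<open>y k\<close>. These have equal norms,
  and their difference is orthogonal to the vectors already matched, so the reflection fixes those.\<close>

lemma ex_orthogonal_transformation_equal_Gram:
  fixes x y :: "'i \<Rightarrow> 'a::euclidean_space"
  assumes "finite I" "\<And>i j. i \<in> I \<Longrightarrow> j \<in> I \<Longrightarrow> x i \<bullet> x j = y i \<bullet> y j"
  shows "\<exists>f. orthogonal_transformation f \<and> (\<forall>i\<in>I. f (x i) = y i)"
  using assms
proof (induction I)
  case empty
  show ?case by (auto intro: orthogonal_transformation_id)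
next
  case (insert k I)
  then obtain f where f: "orthogonal_transformation f" "\<And>i. i \<in> I \<Longrightarrow> f (x i) = y i" by auto
  \<comment> \<open>A normal vector of the hyperplane; if it is \<open>0\<close>, division
    by zero makes the reflection the identity.\<close>
  define n where "n = f (x k) - y k"
  define r where "r z = z - (2 * (z \<bullet> n) / (n \<bullet> n)) *\<^sub>R n" for z
  have fi: "f u \<bullet> f v = u \<bullet> v" for u v using f(1) by (simp add: orthogonal_transformation_def)
  have "y i \<bullet> n = 0" if "i \<in> I" for i
  proof -
    have "y i \<bullet> f (x k) = x i \<bullet> x k" using fi[of "x i" "x k"] f(2)[OF that] by simp
    then show ?thesis using insert.prems[of i k] that by (simp add: n_def inner_diff_right)
  qed
  then have ry: "r (y i) = y i" if "i \<in> I" for i using that by (simp add: r_def)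
  have rk: "r (f (x k)) = y k"
  proof (cases "n = 0")
    case True then show ?thesis by (simp add: r_def n_def)
  next
    case False
    have "f (x k) \<bullet> f (x k) = y k \<bullet> y k" using fi insert.prems[of k k] by simp
    then have "2 * (f (x k) \<bullet> n) = n \<bullet> n"
      by (simp add: n_def inner_diff_left inner_diff_right inner_commute)
    then show ?thesis using False by (simp add: r_def) (simp add: n_def)
  qed
  have "orthogonal_transformation (r \<circ> f)"
    using f(1) orthogonal_transformation_reflection[of n, folded r_def]
    by (intro orthogonal_transformation_compose) (auto simp: r_def[abs_def])
  moreover have "\<forall>i\<in>insert k I. (r \<circ> f) (x i) = y i" using ry rk f(2) by simp
  ultimately show ?case by blast
qed

text \<open>The same for the rows of two matrices, on which an orthogonal matrix acts from the right.\<close>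

lemma ex_orthogonal_matrix_equal_Gram:
  fixes X Y :: "real^'n^'m"
  assumes "X ** transpose X = Y ** transpose Y"
  obtains U :: "real^'n^'n" where "U ** transpose U = mat 1" "X ** U = Y"
proof -
  have gram: "(Z ** transpose Z) $ i $ j = Z $ i \<bullet> Z $ j" for Z :: "real^'n^'m" and i j
    by (simp add: matrix_matrix_mult_def transpose_def inner_vec_def)
  obtain f where f: "orthogonal_transformation f" "\<And>i. f (X $ i) = Y $ i"
    using ex_orthogonal_transformation_equal_Gram[of UNIV "($) X" "($) Y"] assms gram
      by (metis UNIV_I finite)
  define U where "U = transpose (matrix f)"
  have "orthogonal_matrix (matrix f)" using f(1) by (simp add: orthogonal_transformation_matrix)
  then have "U ** transpose U = mat 1" by (simp add: U_def orthogonal_matrix_def)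
  moreover have "(X ** U) $ i = matrix f *v (X $ i)" for i
    by (simp add: U_def vec_eq_iff matrix_matrix_mult_def matrix_vector_mult_def transpose_def mult.commute)
  then have "X ** U = Y"
    using f orthogonal_transformation_linear[OF f(1)] by (simp add: vec_eq_iff)
  ultimately show ?thesis using that by blast
qed

lemma bounded_bilinear_matrix_mult:
  "bounded_bilinear ((**) :: real^'n^'m \<Rightarrow> real^'p^'n \<Rightarrow> real^'p^'m)"
  unfolding bilinear_conv_bounded_bilinear[symmetric] bilinear_def
  by (auto intro!: linearI simp: vec_eq_iff matrix_matrix_mult_def sum.distrib sum_distrib_left algebra_simps)

interpretation matrix_mult: bounded_bilinear "(**) :: real^'n^'m \<Rightarrow> real^'p^'n \<Rightarrow> real^'p^'m"
  by (rule bounded_bilinear_matrix_mult)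

lemma bounded_linear_transpose: "bounded_linear (transpose :: real^'n^'m \<Rightarrow> real^'m^'n)"
  by (auto intro!: linearI simp: linear_conv_bounded_linear[symmetric] transpose_def vec_eq_iff)

lemma transpose_add: "transpose (X + Y) = transpose X + transpose (Y :: real^'n^'m)"
  and transpose_minus: "transpose (- X) = - transpose X"
  and transpose_0: "transpose (0 :: real^'n^'m) = 0"
  by (simp_all add: transpose_def vec_eq_iff)

lemma bounded_linear_trace: "bounded_linear (trace :: real^'n^'n \<Rightarrow> real)"
  by (auto intro!: linearI simp: linear_conv_bounded_linear[symmetric] trace_def sum.distrib sum_distrib_left)

lemma bounded_linear_congruence: "bounded_linear (\<lambda>S :: real^'n^'n. X ** S ** Y)"
  by (intro matrix_mult.bounded_linear_left[THEN bounded_linear_compose] matrix_mult.bounded_linear_right)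

lemma transpose_congruence: "transpose (X ** S ** Y) = transpose Y ** transpose S ** transpose X"
  for X :: "real^'n^'m"
  by (simp add: matrix_transpose_mul matrix_mul_assoc)

lemma inner_congruence:
  fixes X :: "real^'n^'m"
  shows "v \<bullet> ((X ** S ** transpose X) *v v) = (transpose X *v v) \<bullet> (S *v (transpose X *v v))"
  by (simp add: dot_lmul_matrix flip: matrix_vector_mul_assoc)

lemma psd_congruence:
  fixes X :: "real^'n^'m"
  assumes "psd S"
  shows "psd (X ** S ** transpose X)"
  using assms unfolding psd_def symmetric_matrix_def inner_congruence transpose_congruence by simp

lemma psd_add: "psd S \<Longrightarrow> psd T \<Longrightarrow> psd (S + T)"
  by (simp add: psd_def symmetric_matrix_def transpose_add matrix_vector_mult_add_rdistrib inner_add_right)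

lemma psd_scaleR: "psd S \<Longrightarrow> 0 \<le> c \<Longrightarrow> psd (c *\<^sub>R S)"
  by (simp add: psd_def symmetric_matrix_def transpose_scalar flip: scaleR_matrix_vector_assoc)

lemma psd_0: "psd 0"
  by (simp add: psd_def symmetric_matrix_def transpose_0)

lemma psd_sum: "(\<And>i. i \<in> I \<Longrightarrow> psd (S i)) \<Longrightarrow> psd (\<Sum>i\<in>I. S i)"
  by (induction I rule: infinite_finite_induct) (auto intro: psd_add psd_0)

lemma psd_limit:
  fixes S :: "nat \<Rightarrow> real^'n^'n"
  assumes S: "\<And>n. psd (S n)" and lim: "S \<longlonglongrightarrow> T"
  shows "psd T"
proof -
  have "(\<lambda>n. transpose (S n)) \<longlonglongrightarrow> transpose T"
    by (rule bounded_linear.tendsto[OF bounded_linear_transpose lim])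
  moreover have "transpose (S n) = S n" for n using S by (auto simp: psd_def symmetric_matrix_def)
  ultimately have "transpose T = T" using LIMSEQ_unique lim by fastforce
  moreover have "0 \<le> v \<bullet> (T *v v)" for v
  proof (rule LIMSEQ_le_const)
    have bl: "bounded_linear (\<lambda>S :: real^'n^'n. v \<bullet> (S *v v))"
      unfolding linear_conv_bounded_linear[symmetric]
      by (auto intro!: linearI simp: matrix_vector_mult_add_rdistrib inner_add_right simp flip: scaleR_matrix_vector_assoc)
    show "(\<lambda>n. v \<bullet> (S n *v v)) \<longlonglongrightarrow> v \<bullet> (T *v v)"
      by (rule bounded_linear.tendsto[OF bl lim])
  qed (use S in \<open>auto simp: psd_def\<close>)
  ultimately show ?thesis by (simp add: psd_def symmetric_matrix_def)
qed

text \<open>By \<open>(S $ i $ j)\<^sup>2 \<le> S $ i $ i * S $ j $ j\<close>. Bounds on traces, that is on mean squares, thus bound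
  whole moment matrices.\<close>

lemma psd_norm_le_trace:
  fixes S :: "real^'n^'n"
  assumes "psd S"
  shows "norm S \<le> trace S"
proof -
  have diag: "0 \<le> S $ i $ i" for i
    using assms inner_axis_matrix[of i S i] unfolding psd_def by metis
  have "(norm S)\<^sup>2 = (\<Sum>i\<in>UNIV. \<Sum>j\<in>UNIV. (S $ i $ j)\<^sup>2)"
    unfolding power2_norm_eq_inner by (simp add: inner_vec_def power2_eq_square)
  also have "\<dots> \<le> (\<Sum>i\<in>UNIV. \<Sum>j\<in>UNIV. S $ i $ i * S $ j $ j)"
    using psd_Cauchy_Schwarz[OF assms, of "axis _ 1" "axis _ 1"]
    by (intro sum_mono) (simp add: inner_axis_matrix)
  also have "\<dots> = (trace S)\<^sup>2" by (simp add: trace_def power2_eq_square sum_product)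
  finally show ?thesis
    by (rule power2_le_imp_le) (use diag in \<open>auto simp: trace_def sum_nonneg\<close>)
qed

section \<open>The block structure of a covariance matrix\<close>

definition state_block :: "real^('s::finite + ('w::finite + 'w))^'s" where
  "state_block = hcat (mat 1) (hcat 0 0)"

definition dist_block :: "real^('s::finite + ('w::finite + 'w))^'w" where
  "dist_block = hcat 0 (hcat (mat 1) 0)"

definition nom_block :: "real^('s::finite + ('w::finite + 'w))^'w" where
  "nom_block = hcat 0 (hcat 0 (mat 1))"

lemma sum_UNIV_Plus:
  "(\<Sum>i\<in>UNIV. f i) = (\<Sum>a\<in>UNIV. f (Inl a)) + (\<Sum>b\<in>UNIV. f (Inr b))"
  for f :: "'a::finite + 'b::finite \<Rightarrow> 'c::comm_monoid_add"
  by (simp add: sum.Plus flip: UNIV_Plus_UNIV)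

lemma state_block_nth [simp]:
  "state_block $ i $ Inl a = (if i = a then 1 else 0)" "state_block $ i $ Inr b = 0"
  by (auto simp: state_block_def hcat_def mat_def split: sum.split)

lemma dist_block_nth [simp]:
  "dist_block $ i $ Inl a = 0" "dist_block $ i $ Inr (Inl b) = (if i = b then 1 else 0)"
  "dist_block $ i $ Inr (Inr c) = 0"
  by (auto simp: dist_block_def hcat_def mat_def)

lemma nom_block_nth [simp]:
  "nom_block $ i $ Inl a = 0" "nom_block $ i $ Inr (Inl b) = 0"
  "nom_block $ i $ Inr (Inr c) = (if i = c then 1 else 0)"
  by (auto simp: nom_block_def hcat_def mat_def)

lemma hcat_eq_blocks:
  fixes X :: "real^'s^'m" and Y :: "real^'w^'m"
  shows "hcat X (hcat Y 0) = X ** state_block + Y ** dist_block"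
  unfolding vec_eq_iff
proof (intro allI)
  fix i and j :: "'s + ('w + 'w)"
  show "hcat X (hcat Y 0) $ i $ j = (X ** state_block + Y ** dist_block) $ i $ j"
  proof (cases j)
    case (Inl a)
    then show ?thesis by (simp add: hcat_def matrix_matrix_mult_def if_distrib cong: if_cong)
  next
    case (Inr b)
    then show ?thesis
      by (cases b) (simp_all add: hcat_def matrix_matrix_mult_def if_distrib cong: if_cong)
  qed
qed

text \<open>The weight \<open>[I, -I; -I, I]\<close> is \<open>Q\<^sup>T Q\<close> with \<open>Q = [I, -I]\<close>, so the trace is the second moment of
  the difference of the two disturbance components.\<close>

lemma trace_distance_constraint:
  fixes S :: "real^('s::finite + ('w::finite + 'w))^('s + ('w + 'w))"
  defines "G \<equiv> vcat (hcat 0 (hcat (mat 1) 0)) (hcat 0 (hcat 0 (mat 1))) :: real^('s + ('w + 'w))^('w + 'w)"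
  shows "trace (G ** S ** transpose G ** vcat (hcat (mat 1) (- mat 1)) (hcat (- mat 1) (mat 1)))
    = trace ((dist_block - nom_block) ** S ** transpose (dist_block - nom_block))"
proof -
  define Q :: "real^('w + 'w)^'w" where "Q = hcat (mat 1) (- mat 1)"
  have J: "vcat (hcat (mat 1) (- mat 1)) (hcat (- mat 1) (mat 1)) = transpose Q ** Q"
    unfolding vec_eq_iff
  proof (intro allI)
    fix i j :: "'w + 'w"
    have "(transpose Q ** Q) $ i $ j = (\<Sum>k\<in>UNIV. Q $ k $ i * Q $ k $ j)"
      by (simp add: matrix_matrix_mult_def transpose_def)
    then show "vcat (hcat (mat 1) (- mat 1)) (hcat (- mat 1) (mat 1)) $ i $ j = (transpose Q ** Q) $ i $ j"
      by (cases i; cases j)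
         (simp_all add: Q_def vcat_def hcat_def mat_def if_distrib[of "\<lambda>x. x * _"] sum_negf cong: if_cong)
  qed
  have QG: "Q ** G = dist_block - nom_block"
    unfolding vec_eq_iff
  proof (intro allI)
    fix i and j :: "'s + ('w + 'w)"
    have "(Q ** G) $ i $ j = (\<Sum>a\<in>UNIV. mat 1 $ i $ a * dist_block $ a $ j) - (\<Sum>a\<in>UNIV. mat 1 $ i $ a * nom_block $ a $ j)"
      by (simp add: matrix_matrix_mult_def sum_UNIV_Plus Q_def G_def hcat_def[of "mat 1" "- mat 1"]
          vcat_def dist_block_def[symmetric] nom_block_def[symmetric] sum_negf)
    then show "(Q ** G) $ i $ j = (dist_block - nom_block) $ i $ j"
      by (simp add: mat_def if_distrib[of "\<lambda>x. x * _"] cong: if_cong)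
  qed
  have "trace (G ** S ** transpose G ** (transpose Q ** Q)) = trace (Q ** (G ** S ** transpose G ** transpose Q))"
    by (subst trace_mul_sym[symmetric]) (simp add: matrix_mul_assoc)
  also have "Q ** (G ** S ** transpose G ** transpose Q) = (Q ** G) ** S ** transpose (Q ** G)"
    by (simp add: matrix_transpose_mul matrix_mul_assoc)
  finally show ?thesis unfolding J QG .
qed

lemma feasible_III_iff:
  "S \<in> feasible_III d \<gamma> Snom A B \<longleftrightarrow>
     S \<in> covariance_class d \<and> psd S \<and>
     state_block ** S ** transpose state_block
       = (A ** state_block + B ** dist_block) ** S ** transpose (A ** state_block + B ** dist_block) \<and>
     trace ((dist_block - nom_block) ** S ** transpose (dist_block - nom_block)) \<le> \<gamma>\<^sup>2 \<and>
     nom_block ** S ** transpose nom_block = Snom"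
  unfolding feasible_III_def Let_def
  unfolding trace_distance_constraint hcat_eq_blocks[of A B, symmetric]
  unfolding state_block_def[symmetric] nom_block_def[symmetric]
  by auto

text \<open>The mixed terms disappear when the two components \<open>E\<close> and \<open>W\<close> of \<open>S\<close> are uncorrelated.\<close>

lemma congruence_sum_uncorrelated:
  fixes S :: "real^'n^'n" and E :: "real^'n^'s" and W :: "real^'n^'w" and X :: "real^'s^'m" and Y :: "real^'w^'m"
  assumes "transpose S = S" "E ** S ** transpose W = 0"
  shows "(X ** E + Y ** W) ** S ** transpose (X ** E + Y ** W)
    = X ** (E ** S ** transpose E) ** transpose X + Y ** (W ** S ** transpose W) ** transpose Y"
proof -
  have "transpose (E ** S ** transpose W) = 0" using assms(2) by (simp add: transpose_0)
  then have WE: "W ** S ** transpose E = 0" using assms(1) by (simp add: transpose_congruence)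
  have "(X ** E + Y ** W) ** S ** transpose (X ** E + Y ** W)
    = X ** (E ** S ** transpose E) ** transpose X + X ** (E ** S ** transpose W) ** transpose Y
      + (Y ** (W ** S ** transpose E) ** transpose X + Y ** (W ** S ** transpose W) ** transpose Y)"
    by (simp add: transpose_add matrix_transpose_mul matrix_mult.add_left matrix_mult.add_right matrix_mul_assoc)
  then show ?thesis by (simp add: WE assms(2) matrix_mult.zero_left matrix_mult.zero_right)
qed

definition flip_state :: "real^('s::finite + 'v::finite)^('s + 'v)" where
  "flip_state = (\<chi> i j. if i = j then (case i of Inl a \<Rightarrow> -1 | Inr b \<Rightarrow> 1) else 0)"

lemma mult_flip_state:
  fixes X :: "real^('s::finite + 'v::finite)^'m"
  shows "(X ** flip_state) $ i $ j = (case j of Inl a \<Rightarrow> - X $ i $ j | Inr b \<Rightarrow> X $ i $ j)"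
proof -
  define c :: "'s + 'v \<Rightarrow> real" where "c k = (case k of Inl a \<Rightarrow> -1 | Inr b \<Rightarrow> 1)" for k
  have flip: "flip_state $ k $ j = (if k = j then c j else 0)" for k
    by (simp add: flip_state_def c_def)
  have "(X ** flip_state) $ i $ j = (\<Sum>k\<in>UNIV. X $ i $ k * flip_state $ k $ j)"
    by (simp add: matrix_matrix_mult_def)
  also have "\<dots> = X $ i $ j * c j"
    by (simp add: flip if_distrib[of "\<lambda>x. _ * x"] cong: if_cong)
  finally show ?thesis by (cases j) (simp_all add: c_def)
qed

lemma blocks_flip_state:
  "(state_block :: real^('s::finite + ('w::finite + 'w))^'s) ** flip_state = - state_block"
  "(dist_block :: real^('s + ('w + 'w))^'w) ** flip_state = dist_block"
  "(nom_block :: real^('s + ('w + 'w))^'w) ** flip_state = nom_block"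
proof -
  show "(state_block :: real^('s + ('w + 'w))^'s) ** flip_state = - state_block"
    unfolding vec_eq_iff
  proof (intro allI)
    show "((state_block :: real^('s + ('w + 'w))^'s) ** flip_state) $ i $ j = (- state_block) $ i $ j" for i j
      by (cases j) (simp_all add: mult_flip_state)
  qed
  show "(dist_block :: real^('s + ('w + 'w))^'w) ** flip_state = dist_block"
    unfolding vec_eq_iff
  proof (intro allI)
    show "((dist_block :: real^('s + ('w + 'w))^'w) ** flip_state) $ i $ j = dist_block $ i $ j"
      for i j
      by (cases j) (simp_all add: mult_flip_state)
  qed
  show "(nom_block :: real^('s + ('w + 'w))^'w) ** flip_state = nom_block"
    unfolding vec_eq_iff
  proof (intro allI)
    show "((nom_block :: real^('s + ('w + 'w))^'w) ** flip_state) $ i $ j = nom_block $ i $ j"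
      for i j
      by (cases j) (simp_all add: mult_flip_state)
  qed
qed

lemma block_entries:
  fixes S :: "real^('s::finite + ('w::finite + 'w))^('s + ('w + 'w))"
  shows "(state_block ** S ** transpose dist_block) $ i $ j = S $ Inl i $ Inr (Inl j)"
    and "(state_block ** S ** transpose nom_block) $ i $ j = S $ Inl i $ Inr (Inr j)"
  by (simp_all add: matrix_matrix_mult_def transpose_def sum_UNIV_Plus
      if_distrib[of "\<lambda>x. x * _"] if_distrib[of "\<lambda>x. _ * x"] cong: if_cong)

lemma covariance_class_Ind_iff:
  "S \<in> covariance_class Ind \<longleftrightarrow> symmetric_matrix S \<and>
    state_block ** S ** transpose dist_block = 0 \<and> state_block ** S ** transpose nom_block = 0"
  by (auto simp: covariance_class_def vec_eq_iff block_entries)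

text \<open>If \<open>S\<close> is the moment matrix of \<open>(x, v)\<close>, then that of \<open>(-x, v)\<close> differs only in the sign of the
  correlation of \<open>x\<close> and \<open>v\<close>. The mean of the two is positive semidefinite and has no such
  correlation.\<close>

definition decouple :: "real^('s::finite + 'v::finite)^('s + 'v) \<Rightarrow> real^('s + 'v)^('s + 'v)" where
  "decouple S = (1 / 2) *\<^sub>R (S + flip_state ** S ** transpose flip_state)"

lemma congruence_decouple:
  "X ** decouple S ** transpose Y
    = (1 / 2) *\<^sub>R (X ** S ** transpose Y + (X ** flip_state) ** S ** transpose (Y ** flip_state))"
  by (simp add: decouple_def matrix_mult.scaleR_left matrix_mult.scaleR_right matrix_mult.add_left
      matrix_mult.add_right matrix_transpose_mul matrix_mul_assoc)

text \<open>Decoupling leaves all constraints and the objective unchanged as soon as the state and the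
  disturbance are uncorrelated, because the correlation of the state with the nominal disturbance
  enters none of them.\<close>

lemma decouple_properties:
  fixes S :: "real^('s::finite + ('w::finite + 'w))^('s + ('w + 'w))"
  assumes psd: "psd S" and uncor: "state_block ** S ** transpose dist_block = 0"
  shows "decouple S \<in> covariance_class Ind" "psd (decouple S)"
    "state_block ** decouple S ** transpose state_block = state_block ** S ** transpose state_block"
    "\<And>X Y. (X ** state_block + Y ** dist_block) ** decouple S ** transpose (X ** state_block + Y ** dist_block)
      = (X ** state_block + Y ** dist_block) ** S ** transpose (X ** state_block + Y ** dist_block)"
    "(dist_block - nom_block) ** decouple S ** transpose (dist_block - nom_block)
      = (dist_block - nom_block) ** S ** transpose (dist_block - nom_block)"
    "nom_block ** decouple S ** transpose nom_block = nom_block ** S ** transpose nom_block"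
proof -
  have half: "(1 / 2) *\<^sub>R (x + x) = x" for x :: "'z::real_vector" by (simp flip: scaleR_2)
  show p: "psd (decouple S)"
    unfolding decouple_def using psd by (intro psd_scaleR psd_add psd_congruence) auto
  show "decouple S \<in> covariance_class Ind"
    using p unfolding covariance_class_Ind_iff psd_def
    by (simp add: congruence_decouple blocks_flip_state matrix_mult.minus_left)
  have sym: "transpose S = S" using psd by (simp add: psd_def symmetric_matrix_def)
  show e: "state_block ** decouple S ** transpose state_block = state_block ** S ** transpose state_block"
    by (simp add: congruence_decouple blocks_flip_state transpose_minus matrix_mult.minus_left matrix_mult.minus_right half)
  have d: "dist_block ** decouple S ** transpose dist_block = dist_block ** S ** transpose dist_block"
    by (simp add: congruence_decouple blocks_flip_state half)
  have x: "state_block ** decouple S ** transpose dist_block = 0"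
    by (simp add: congruence_decouple blocks_flip_state matrix_mult.minus_left)
  show "(X ** state_block + Y ** dist_block) ** decouple S ** transpose (X ** state_block + Y ** dist_block)
      = (X ** state_block + Y ** dist_block) ** S ** transpose (X ** state_block + Y ** dist_block)" for X Y
    using p unfolding psd_def symmetric_matrix_def
    by (simp add: congruence_sum_uncorrelated x e d uncor sym)
  show "(dist_block - nom_block) ** decouple S ** transpose (dist_block - nom_block)
      = (dist_block - nom_block) ** S ** transpose (dist_block - nom_block)"
    by (simp add: congruence_decouple blocks_flip_state matrix_mult.diff_left half)
  show "nom_block ** decouple S ** transpose nom_block = nom_block ** S ** transpose nom_block"
    by (simp add: congruence_decouple blocks_flip_state half)
qed

definition joint :: "real^'s \<Rightarrow> real^'w \<Rightarrow> real^'w \<Rightarrow> real^('s + ('w + 'w))" where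
  "joint x y z = (\<chi> i. case i of Inl a \<Rightarrow> x $ a | Inr (Inl b) \<Rightarrow> y $ b | Inr (Inr c) \<Rightarrow> z $ c)"

lemma blocks_joint:
  "state_block *v joint x y z = x" "dist_block *v joint x y z = y" "nom_block *v joint x y z = z"
  by (simp_all add: vec_eq_iff matrix_vector_mult_def sum_UNIV_Plus joint_def
      if_distrib[of "\<lambda>x. x * _"] cong: if_cong)

lemma norm_joint_sq: "(norm (joint x y z))\<^sup>2 = (norm x)\<^sup>2 + (norm y)\<^sup>2 + (norm z)\<^sup>2"
  by (simp add: norm_sq_eq_sum sum_UNIV_Plus joint_def)

lemma L2_joint:
  assumes "f \<in> L2 M" "g \<in> L2 M" "h \<in> L2 M"
  shows "(\<lambda>\<omega>. joint (f \<omega>) (g \<omega>) (h \<omega>)) \<in> L2 M"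
proof -
  have "(\<lambda>\<omega>. joint (f \<omega>) (g \<omega>) (h \<omega>)) \<in> borel_measurable M"
    unfolding borel_measurable_vec_iff
  proof
    show "(\<lambda>\<omega>. joint (f \<omega>) (g \<omega>) (h \<omega>) $ i) \<in> borel_measurable M" for i
      using assms[THEN L2_D(1)] unfolding borel_measurable_vec_iff
    proof (cases i)
      case (Inr b)
      then show ?thesis
        using assms(2,3)[THEN L2_D(1)] unfolding borel_measurable_vec_iff
        by (cases b) (simp_all add: joint_def)
    qed (simp add: joint_def)
  qed
  then show ?thesis using assms[THEN L2_D(2)] by (simp add: L2_def norm_joint_sq)
qed

section \<open>From processes to covariance matrices\<close>

lemma L2_cl_state:
  assumes "\<And>t. w t \<in> L2 M"
  shows "cl_state A B w t \<in> L2 M"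
  by (induction t) (simp_all add: L2_zero L2_add L2_matrix_vector_mult assms)

lemma cl_state_eq_sum:
  "cl_state A B w t \<omega> = (\<Sum>k<t. ((*v) A ^^ k) (B *v w (t - 1 - k) \<omega>))"
proof (induction t)
  case (Suc t)
  have "cl_state A B w (Suc t) \<omega> = B *v w t \<omega> + (\<Sum>k<t. A *v ((*v) A ^^ k) (B *v w (t - 1 - k) \<omega>))"
    by (simp add: Suc.IH linear_sum[OF matrix_vector_mul_linear])
  also have "(\<Sum>k<t. A *v ((*v) A ^^ k) (B *v w (t - 1 - k) \<omega>))
      = (\<Sum>k<t. ((*v) A ^^ Suc k) (B *v w (Suc t - 1 - Suc k) \<omega>))"
    by (intro sum.cong) auto
  finally show ?case by (subst sum.lessThan_Suc_shift) simp
qed simp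

text \<open>The state is a convolution of the disturbance with summable kernel norms \<open>a k\<close>. Pointwise
  Cauchy-Schwarz with weights \<open>sqrt (a k)\<close> gives \<open>(\<Sum>a k * u k)\<^sup>2 \<le> (\<Sum>a k) * (\<Sum>a k * (u k)\<^sup>2)\<close>, which
  can be integrated term by term.\<close>

lemma cl_state_mean_square_bounded:
  fixes A :: "real^'s^'s" and B :: "real^'w^'s"
  assumes A: "stable_matrix A" and w: "\<And>t. w t \<in> L2 M"
    and b: "\<And>t. (\<integral>\<omega>. (norm (w t \<omega>))\<^sup>2 \<partial>M) \<le> b"
  shows "\<exists>c. \<forall>t. (\<integral>\<omega>. (norm (cl_state A B w t \<omega>))\<^sup>2 \<partial>M) \<le> c"
proof -
  obtain a where a: "summable a" "\<And>k. 0 \<le> a k" "\<And>k x. norm (((*v) A ^^ k) x) \<le> a k * norm x"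
    using stable_matrix_power_bound[OF A] by blast
  define \<alpha> where "\<alpha> = suminf a"
  define \<beta> where "\<beta> = (onorm ((*v) B))\<^sup>2"
  have \<alpha>: "(\<Sum>k<t. a k) \<le> \<alpha>" for t unfolding \<alpha>_def using a by (intro sum_le_suminf) auto
  have \<alpha>0: "0 \<le> \<alpha>" using \<alpha>[of 0] by simp
  have \<beta>0: "0 \<le> \<beta>" by (simp add: \<beta>_def)
  have b0: "0 \<le> b" by (rule order_trans[OF integral_nonneg_AE b[of 0]]) simp
  have "(norm (B *v x))\<^sup>2 \<le> \<beta> * (norm x)\<^sup>2" for x
    unfolding \<beta>_def power_mult_distrib[symmetric] by (rule power_mono[OF onorm]) auto
  then have Bw: "(norm (B *v w s \<omega>))\<^sup>2 \<le> \<beta> * (norm (w s \<omega>))\<^sup>2" for s \<omega> .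
  have pt: "(norm (cl_state A B w t \<omega>))\<^sup>2 \<le> \<alpha> * (\<Sum>k<t. a k * (\<beta> * (norm (w (t - 1 - k) \<omega>))\<^sup>2))"
    for t \<omega>
  proof -
    let ?u = "\<lambda>k. norm (B *v w (t - 1 - k) \<omega>)"
    have "norm (cl_state A B w t \<omega>) \<le> (\<Sum>k<t. a k * ?u k)"
      unfolding cl_state_eq_sum by (intro order_trans[OF norm_sum] sum_mono a)
    then have "(norm (cl_state A B w t \<omega>))\<^sup>2 \<le> (\<Sum>k<t. sqrt (a k) * (sqrt (a k) * ?u k))\<^sup>2"
      using a(2) by (intro power_mono) (auto simp flip: mult.assoc)
    also have "\<dots> \<le> (\<Sum>k<t. (sqrt (a k))\<^sup>2) * (\<Sum>k<t. (sqrt (a k) * ?u k)\<^sup>2)"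
      by (rule Cauchy_Schwarz_ineq_sum)
    also have "\<dots> = (\<Sum>k<t. a k) * (\<Sum>k<t. a k * (?u k)\<^sup>2)"
      using a(2) by (simp add: power_mult_distrib)
    also have "\<dots> \<le> \<alpha> * (\<Sum>k<t. a k * (\<beta> * (norm (w (t - 1 - k) \<omega>))\<^sup>2))"
      using a(2) \<alpha> \<alpha>0 Bw by (intro mult_mono sum_mono mult_left_mono sum_nonneg) auto
    finally show ?thesis .
  qed
  have "(\<integral>\<omega>. (norm (cl_state A B w t \<omega>))\<^sup>2 \<partial>M) \<le> \<alpha> * (\<alpha> * (\<beta> * b))" for t
  proof -
    have "(\<integral>\<omega>. (norm (cl_state A B w t \<omega>))\<^sup>2 \<partial>M)
        \<le> (\<integral>\<omega>. \<alpha> * (\<Sum>k<t. a k * (\<beta> * (norm (w (t - 1 - k) \<omega>))\<^sup>2)) \<partial>M)"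
      using L2_D(2)[OF w] L2_D(2)[OF L2_cl_state[OF w]] pt by (intro integral_mono) auto
    also have "\<dots> = \<alpha> * (\<Sum>k<t. a k * (\<beta> * (\<integral>\<omega>. (norm (w (t - 1 - k) \<omega>))\<^sup>2 \<partial>M)))"
      using L2_D(2)[OF w] by simp
    also have "\<dots> \<le> \<alpha> * (\<Sum>k<t. a k * (\<beta> * b))"
      using a(2) \<alpha>0 \<beta>0 b by (intro mult_left_mono sum_mono) auto
    also have "\<dots> = \<alpha> * ((\<Sum>k<t. a k) * (\<beta> * b))" by (simp add: sum_distrib_right)
    also have "\<dots> \<le> \<alpha> * (\<alpha> * (\<beta> * b))"
      using \<alpha> \<alpha>0 \<beta>0 b0 by (intro mult_left_mono mult_right_mono) auto
    finally show ?thesis .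
  qed
  then show ?thesis by blast
qed

lemma (in prob_space) indep_centred_cross_moment:
  fixes w :: "nat \<Rightarrow> 'a \<Rightarrow> real^'n"
  assumes w: "\<And>t. w t \<in> L2 M" and ind: "indep_vars (\<lambda>_. borel) w UNIV"
    and mean: "\<And>t. expectation (w t) = 0" and st: "s \<noteq> t"
  shows "cross_moment M (w s) (w t) = 0"
proof -
  have "expectation (\<lambda>\<omega>. w s \<omega> $ i * w t \<omega> $ j) = 0" for i j
  proof -
    have wi: "integrable M (w r)" for r by (rule L2_imp_integrable[OF w])
    have comp: "integrable M (\<lambda>\<omega>. w r \<omega> $ k)" "expectation (\<lambda>\<omega>. w r \<omega> $ k) = 0" for r k
    proof -
      have "integrable M (\<lambda>\<omega>. w r \<omega> \<bullet> axis k 1)"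
        "expectation (\<lambda>\<omega>. w r \<omega> \<bullet> axis k 1) = expectation (w r) \<bullet> axis k 1"
        by (rule integrable_inner_left integral_inner_left, rule wi)+
      then show "integrable M (\<lambda>\<omega>. w r \<omega> $ k)" "expectation (\<lambda>\<omega>. w r \<omega> $ k) = 0"
        using mean[of r] by (simp_all add: inner_axis)
    qed
    define Y where "Y r x = x $ (if r = s then i else j)" for r :: nat and x :: "real^'n"
    have "indep_vars (\<lambda>_. borel) (\<lambda>r \<omega>. Y r (w r \<omega>)) {s, t}"
      using indep_vars_subset[OF ind, of "{s, t}"]
        by (rule indep_vars_compose2) (simp_all add: Y_def)
    then have "expectation (\<lambda>\<omega>. \<Prod>r\<in>{s, t}. Y r (w r \<omega>)) = (\<Prod>r\<in>{s, t}. expectation (\<lambda>\<omega>. Y r (w r \<omega>)))"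
      using comp(1) by (intro indep_vars_lebesgue_integral) (auto simp: Y_def)
    then show ?thesis using st comp(2) by (simp add: Y_def)
  qed
  then show ?thesis by (simp add: cross_moment_def vec_eq_iff)
qed

text \<open>The state at time \<open>t\<close> is a linear combination of earlier disturbances, each of them uncorrelated
  with \<open>w t\<close>. The induction runs over the time \<open>s \<le> t\<close> of the state with \<open>t\<close> fixed.\<close>

lemma (in prob_space) cl_state_uncorrelated:
  fixes w :: "nat \<Rightarrow> 'a \<Rightarrow> real^'w"
  assumes w: "\<And>t. w t \<in> L2 M" and ind: "indep_vars (\<lambda>_. borel) w UNIV"
    and mean: "\<And>t. expectation (w t) = 0"
  shows "cross_moment M (cl_state A B w t) (w t) = 0"
proof -
  have "s \<le> t \<Longrightarrow> cross_moment M (cl_state A B w s) (w t) = 0" for s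
  proof (induction s)
    case 0
    then show ?case by (simp add: cross_moment_def vec_eq_iff)
  next
    case (Suc s)
    then show ?case
      using indep_centred_cross_moment[OF w ind mean, of s t]
      by (simp add: cross_moment_add_left cross_moment_mult_left L2_matrix_vector_mult L2_cl_state w
          matrix_mult.zero_right)
  qed
  then show ?thesis by simp
qed

lemma feasible_II_second_moment:
  fixes P :: "(real^'w) measure"
  assumes P: "zero_mean_normal P" and feas: "feasible_II d \<gamma> P M w w'"
  shows "cross_moment M (w' t) (w' t) = second_moment P"
    "(\<integral>\<omega>. (norm (w' t \<omega>))\<^sup>2 \<partial>M) = trace (second_moment P)"
    "(\<integral>\<omega>. (norm (w t \<omega>))\<^sup>2 \<partial>M) \<le> 2 * \<gamma>\<^sup>2 + 2 * trace (second_moment P)"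
proof -
  have w: "w t \<in> L2 M" "w' t \<in> L2 M" and dist: "(\<integral>\<omega>. (norm (w t \<omega> - w' t \<omega>))\<^sup>2 \<partial>M) \<le> \<gamma>\<^sup>2"
    and law: "distr M borel (w' t) = P"
    using feas by (auto simp: feasible_II_def)
  show 1: "cross_moment M (w' t) (w' t) = second_moment P"
    using cross_moment_distr[OF L2_D(1)[OF w(2)], of "\<lambda>x. x" "\<lambda>x. x"]
    by (simp add: law second_moment_eq_cross_moment)
  then show 2: "(\<integral>\<omega>. (norm (w' t \<omega>))\<^sup>2 \<partial>M) = trace (second_moment P)"
    by (simp add: integral_norm_sq_eq_trace[OF w(2)])
  have "(- mat 1) *v v = - v" for v :: "real^'w"
    using matrix_vector_mult_diff_rdistrib[of 0 "mat 1" v] by simp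
  then have "(\<lambda>\<omega>. w t \<omega> - w' t \<omega>) \<in> L2 M"
    using L2_add[OF w(1) L2_matrix_vector_mult[OF w(2), of "- mat 1"]] by simp
  note i = L2_D(2)[OF this] L2_D(2)[OF w(1)] L2_D(2)[OF w(2)]
  have "(norm x)\<^sup>2 \<le> 2 * (norm (x - y))\<^sup>2 + 2 * (norm y)\<^sup>2" for x y :: "real^'w"
  proof -
    have "(norm x)\<^sup>2 \<le> (norm (x - y) + norm y)\<^sup>2"
      using norm_triangle_sub[of x y] by (intro power_mono) simp_all
    also have "\<dots> \<le> 2 * (norm (x - y))\<^sup>2 + 2 * (norm y)\<^sup>2"
      using sum_squares_bound[of "norm (x - y)" "norm y"] by (simp add: power2_sum)
    finally show ?thesis .
  qed
  then have "(\<integral>\<omega>. (norm (w t \<omega>))\<^sup>2 \<partial>M) \<le> (\<integral>\<omega>. 2 * (norm (w t \<omega> - w' t \<omega>))\<^sup>2 + 2 * (norm (w' t \<omega>))\<^sup>2 \<partial>M)"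
    using i by (intro integral_mono) auto
  also have "\<dots> = 2 * (\<integral>\<omega>. (norm (w t \<omega> - w' t \<omega>))\<^sup>2 \<partial>M) + 2 * trace (second_moment P)"
    using i 2 by simp
  finally show "(\<integral>\<omega>. (norm (w t \<omega>))\<^sup>2 \<partial>M) \<le> 2 * \<gamma>\<^sup>2 + 2 * trace (second_moment P)"
    using dist by simp
qed

text \<open>The cost of every candidate is the objective value of some feasible covariance matrix: a limit of
  time-averaged moment matrices along times that realize the limsup, decoupled in the independent
  case.\<close>

theorem average_cost_attained_by_covariance:
  fixes A :: "real^'s^'s" and B :: "real^'w^'s" and C :: "real^'s^'z" and D :: "real^'w^'z"
    and P :: "(real^'w) measure"
  assumes A: "stable_matrix A" and P: "zero_mean_normal P" and M: "prob_space M"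
    and feas: "feasible_II d \<gamma> P M w w'"
  obtains S where "S \<in> feasible_III d \<gamma> (second_moment P) A B"
    "average_cost A B C D M w
      = ereal (trace ((C ** state_block + D ** dist_block) ** S ** transpose (C ** state_block + D ** dist_block)))"
proof -
  interpret prob_space M by fact
  have w: "w t \<in> L2 M" "w' t \<in> L2 M" for t using feas by (auto simp: feasible_II_def)
  have dist: "(\<integral>\<omega>. (norm (w t \<omega> - w' t \<omega>))\<^sup>2 \<partial>M) \<le> \<gamma>\<^sup>2" for t
    using feas by (auto simp: feasible_II_def)
  define x where "x = cl_state A B w"
  have x: "x t \<in> L2 M" for t unfolding x_def by (rule L2_cl_state) (rule w)
  define F where "F = A ** state_block + B ** (dist_block :: real^('s + ('w + 'w))^'w)"
  define K where "K = C ** state_block + D ** (dist_block :: real^('s + ('w + 'w))^'w)"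
  define \<xi> where "\<xi> t \<omega> = joint (x t \<omega>) (w t \<omega>) (w' t \<omega>)" for t \<omega>
  have \<xi>: "\<xi> t \<in> L2 M" for t using L2_joint[OF x w, of t t t] unfolding \<xi>_def .
  define S where "S t = cross_moment M (\<xi> t) (\<xi> t)" for t
  have cong: "X ** S t ** transpose X = cross_moment M (\<lambda>\<omega>. X *v \<xi> t \<omega>) (\<lambda>\<omega>. X *v \<xi> t \<omega>)"
    for X :: "real^('s + ('w + 'w))^'m" and t
    unfolding S_def by (rule cross_moment_congruence[OF \<xi>, symmetric])
  have tr: "trace (X ** S t ** transpose X) = (\<integral>\<omega>. (norm (X *v \<xi> t \<omega>))\<^sup>2 \<partial>M)"
    for X :: "real^('s + ('w + 'w))^'m" and t
    unfolding cong by (rule integral_norm_sq_eq_trace[OF L2_matrix_vector_mult[OF \<xi>], symmetric])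
  have F\<xi>: "F *v \<xi> t \<omega> = x (Suc t) \<omega>" for t \<omega>
    by (simp add: F_def \<xi>_def x_def matrix_vector_mult_add_rdistrib blocks_joint flip: matrix_vector_mul_assoc)
  have K\<xi>: "K *v \<xi> t \<omega> = cl_output A B C D w t \<omega>" for t \<omega>
    by (simp add: K_def \<xi>_def x_def cl_output_def matrix_vector_mult_add_rdistrib blocks_joint flip: matrix_vector_mul_assoc)
  have E\<xi>: "state_block *v \<xi> t \<omega> = x t \<omega>" for t \<omega> by (simp add: \<xi>_def blocks_joint)
  have dyn: "F ** S t ** transpose F = state_block ** S (Suc t) ** transpose state_block" for t
    by (simp add: cong F\<xi> E\<xi>)
  have x0: "state_block ** S 0 ** transpose state_block = 0"
    by (simp add: cong E\<xi> x_def cross_moment_def vec_eq_iff)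
  have psdS: "psd (S t)" for t unfolding S_def by (rule cross_moment_psd[OF \<xi>])
  have distS: "trace ((dist_block - nom_block) ** S t ** transpose (dist_block - nom_block)) \<le> \<gamma>\<^sup>2"
    for t
    using dist[of t] by (simp add: tr \<xi>_def matrix_vector_mult_diff_rdistrib blocks_joint)
  have nomS: "nom_block ** S t ** transpose nom_block = second_moment P" for t
    using feasible_II_second_moment(1)[OF P feas] by (simp add: cong \<xi>_def blocks_joint)
  have wbound: "(\<integral>\<omega>. (norm (w t \<omega>))\<^sup>2 \<partial>M) \<le> 2 * \<gamma>\<^sup>2 + 2 * trace (second_moment P)" for t
    by (rule feasible_II_second_moment(3)[OF P feas])
  obtain c where c: "\<And>t. (\<integral>\<omega>. (norm (x t \<omega>))\<^sup>2 \<partial>M) \<le> c"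
    using cl_state_mean_square_bounded[where B = B and w = w, OF A w(1) wbound] unfolding x_def
      by blast
  define b where "b = c + (2 * \<gamma>\<^sup>2 + 2 * trace (second_moment P)) + trace (second_moment P)"
  have normS: "norm (S t) \<le> b" for t
  proof -
    have "norm (S t) \<le> trace (S t)" by (rule psd_norm_le_trace[OF psdS])
    also have "\<dots> = (\<integral>\<omega>. (norm (\<xi> t \<omega>))\<^sup>2 \<partial>M)"
      unfolding S_def by (rule integral_norm_sq_eq_trace[OF \<xi>, symmetric])
    also have "\<dots> = (\<integral>\<omega>. (norm (x t \<omega>))\<^sup>2 \<partial>M) + (\<integral>\<omega>. (norm (w t \<omega>))\<^sup>2 \<partial>M) + (\<integral>\<omega>. (norm (w' t \<omega>))\<^sup>2 \<partial>M)"
      using L2_D(2)[OF x] L2_D(2)[OF w(1)] L2_D(2)[OF w(2)] by (simp add: \<xi>_def norm_joint_sq)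
    also have "\<dots> \<le> b"
      unfolding b_def using c wbound feasible_II_second_moment(2)[OF P feas]
        by (intro add_mono) auto
    finally show ?thesis .
  qed
  \<comment> \<open>For \<open>T = 0\<close> the average is \<open>0\<close>; the estimates below cover this value too.\<close>
  define Sav where "Sav T = (1 / real T) *\<^sub>R (\<Sum>t<T. S t)" for T
  have avg: "f (Sav T) = (1 / real T) *\<^sub>R (\<Sum>t<T. f (S t))" if "bounded_linear f"
    for f :: "real^('s + ('w + 'w))^('s + ('w + 'w)) \<Rightarrow> 'v::real_normed_vector" and T
    using bounded_linear.linear[OF that] by (simp add: Sav_def linear_scale linear_sum)
  have bl_tr: "bounded_linear (\<lambda>S :: real^('s + ('w + 'w))^('s + ('w + 'w)). trace (X ** S ** Y))"
    for X :: "real^('s + ('w + 'w))^'m" and Y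
    by (rule bounded_linear_compose[OF bounded_linear_trace bounded_linear_congruence])
  have psdSav: "psd (Sav T)" for T
    unfolding Sav_def using psdS by (intro psd_scaleR psd_sum) auto
  have "norm (Sav T) \<le> b" for T
  proof -
    have "norm (\<Sum>t<T. S t) \<le> (\<Sum>t<T. b)" by (intro order_trans[OF norm_sum] sum_mono normS)
    then have "norm (Sav T) \<le> 1 / real T * (real T * b)"
      unfolding Sav_def norm_scaleR by (intro mult_mono) auto
    also have "\<dots> \<le> b" using order_trans[OF norm_ge_zero normS[of 0]] by (cases "T = 0") auto
    finally show ?thesis .
  qed
  then have bdd: "bounded (range Sav)" by (auto simp: bounded_iff)
  define cost where "cost T = 1 / real T * (\<Sum>t<T. \<integral>\<omega>. (norm (cl_output A B C D w t \<omega>))\<^sup>2 \<partial>M)" for T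
  have cost: "cost T = trace (K ** Sav T ** transpose K)" for T
    by (simp add: avg[OF bl_tr] tr K\<xi> cost_def)
  have avc: "average_cost A B C D M w = limsup (\<lambda>T. ereal (cost T))"
    by (simp add: average_cost_def cost_def)
  obtain r where r: "strict_mono r" "((\<lambda>T. ereal (cost T)) \<circ> r) \<longlonglongrightarrow> average_cost A B C D M w"
    using limsup_subseq_lim[of "\<lambda>T. ereal (cost T)"] unfolding avc by blast
  have "bounded (range (Sav \<circ> r))" using bdd by (rule bounded_subset) auto
  then obtain Slim r' where r': "strict_mono r'" "(Sav \<circ> r \<circ> r') \<longlonglongrightarrow> Slim"
    using bounded_imp_convergent_subsequence by blast
  define q where "q = r \<circ> r'"
  have q: "strict_mono q" using r(1) r'(1) by (simp add: q_def strict_mono_o)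
  have lim: "(\<lambda>n. Sav (q n)) \<longlonglongrightarrow> Slim" using r'(2) by (simp add: q_def comp_def)
  have flim: "(\<lambda>n. f (Sav (q n))) \<longlonglongrightarrow> f Slim" if "bounded_linear f"
    for f :: "real^('s + ('w + 'w))^('s + ('w + 'w)) \<Rightarrow> 'v::real_normed_vector"
    by (rule bounded_linear.tendsto[OF that lim])
  have qpos: "\<forall>\<^sub>F n in sequentially. 0 < q n"
    by (rule eventually_mono[OF eventually_gt_at_top[of 0]]) (rule less_le_trans[OF _ seq_suble[OF q]])
  have costlim: "average_cost A B C D M w = ereal (trace (K ** Slim ** transpose K))"
  proof (rule LIMSEQ_unique)
    show "(\<lambda>n. ereal (cost (q n))) \<longlonglongrightarrow> average_cost A B C D M w"
      using LIMSEQ_subseq_LIMSEQ[OF r(2) r'(1)] by (simp add: q_def comp_def)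
    show "(\<lambda>n. ereal (cost (q n))) \<longlonglongrightarrow> ereal (trace (K ** Slim ** transpose K))"
      using flim[OF bl_tr] by (simp add: cost)
  qed
  have psdI: "psd Slim" by (rule psd_limit[OF psdSav lim])
  have distI: "trace ((dist_block - nom_block) ** Slim ** transpose (dist_block - nom_block)) \<le> \<gamma>\<^sup>2"
  proof (rule LIMSEQ_le_const2[OF flim[OF bl_tr]])
    have "trace ((dist_block - nom_block) ** Sav T ** transpose (dist_block - nom_block)) \<le> \<gamma>\<^sup>2"
      for T
    proof -
      have "trace ((dist_block - nom_block) ** Sav T ** transpose (dist_block - nom_block)) \<le> 1 / real T * (real T * \<gamma>\<^sup>2)"
        unfolding avg[OF bl_tr] real_scaleR_def
        using sum_mono[of "{..<T}" _ "\<lambda>_. \<gamma>\<^sup>2", OF distS] by (intro mult_left_mono) auto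
      also have "\<dots> \<le> \<gamma>\<^sup>2" by (cases "T = 0") auto
      finally show ?thesis .
    qed
    then show "\<exists>N. \<forall>n\<ge>N. trace ((dist_block - nom_block) ** Sav (q n) ** transpose (dist_block - nom_block)) \<le> \<gamma>\<^sup>2"
      by blast
  qed
  have nomI: "nom_block ** Slim ** transpose nom_block = second_moment P"
  proof (rule LIMSEQ_unique[OF flim[OF bounded_linear_congruence]])
    have "\<forall>\<^sub>F n in sequentially. nom_block ** Sav (q n) ** transpose nom_block = second_moment P"
      using qpos
        by eventually_elim (simp add: avg[OF bounded_linear_congruence] nomS sum_constant_scaleR del: sum_constant)
    then show "(\<lambda>n. nom_block ** Sav (q n) ** transpose nom_block) \<longlonglongrightarrow> second_moment P"
      by (rule tendsto_eventually)
  qed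
  \<comment> \<open>The stationarity defect of an average telescopes to the last state covariance divided by \<open>T\<close>.\<close>
  have dynI: "state_block ** Slim ** transpose state_block = F ** Slim ** transpose F"
  proof -
    define X where "X t = state_block ** S t ** transpose state_block" for t
    have gap: "state_block ** Sav T ** transpose state_block - F ** Sav T ** transpose F
        = - ((1 / real T) *\<^sub>R X T)" for T
    proof -
      have "state_block ** Sav T ** transpose state_block - F ** Sav T ** transpose F
          = (1 / real T) *\<^sub>R (\<Sum>t<T. X t - X (Suc t))"
        by (simp add: avg[OF bounded_linear_congruence] dyn X_def scaleR_diff_right sum_subtractf)
      also have "(\<Sum>t<T. X t - X (Suc t)) = - X T"
        using x0 unfolding sum_lessThan_telescope' by (simp add: X_def)
      finally show ?thesis by simp
    qed
    have Xb: "norm (X t) \<le> c" for t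
    proof -
      have "norm (X t) \<le> trace (X t)" unfolding X_def
        by (intro psd_norm_le_trace psd_congruence psdS)
      also have "\<dots> = (\<integral>\<omega>. (norm (x t \<omega>))\<^sup>2 \<partial>M)" by (simp add: X_def tr E\<xi>)
      finally show ?thesis using c[of t] by simp
    qed
    have "(\<lambda>T. (1 / real T) *\<^sub>R X T) \<longlonglongrightarrow> 0"
    proof (rule Lim_null_comparison)
      show "\<forall>\<^sub>F T in sequentially. norm ((1 / real T) *\<^sub>R X T) \<le> c / real T"
        using Xb by (intro always_eventually allI) (simp add: divide_right_mono)
      show "(\<lambda>T. c / real T) \<longlonglongrightarrow> 0" by (rule lim_const_over_n)
    qed
    then have "(\<lambda>T. - ((1 / real T) *\<^sub>R X T)) \<longlonglongrightarrow> 0" using tendsto_minus by fastforce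
    then have "(\<lambda>n. state_block ** Sav (q n) ** transpose state_block - F ** Sav (q n) ** transpose F) \<longlonglongrightarrow> 0"
      unfolding gap by (rule filterlim_compose[OF _ filterlim_subseq[OF q]])
    moreover have "(\<lambda>n. state_block ** Sav (q n) ** transpose state_block - F ** Sav (q n) ** transpose F)
        \<longlonglongrightarrow> state_block ** Slim ** transpose state_block - F ** Slim ** transpose F"
      by (intro tendsto_diff flim bounded_linear_congruence)
    ultimately show ?thesis using LIMSEQ_unique by fastforce
  qed
  show ?thesis
  proof (cases d)
    case Cor
    have "Slim \<in> feasible_III d \<gamma> (second_moment P) A B"
      unfolding feasible_III_iff F_def[symmetric] using Cor psdI distI nomI dynI
      by (auto simp: covariance_class_def psd_def)
    then show ?thesis using that costlim unfolding K_def by blast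
  next
    case Ind
    have unc: "state_block ** S t ** transpose dist_block = 0" for t
    proof -
      have "state_block ** S t ** transpose dist_block = cross_moment M (x t) (w t)"
        unfolding S_def
        using cross_moment_mult_left[OF \<xi> \<xi>, of state_block t t]
          cross_moment_mult_right[OF L2_matrix_vector_mult[OF \<xi>] \<xi>, of state_block t dist_block t]
        by (simp add: \<xi>_def blocks_joint)
      also have "\<dots> = 0"
        unfolding x_def using feas Ind w(1)
          by (intro cl_state_uncorrelated) (auto simp: feasible_II_def)
      finally show ?thesis .
    qed
    have "state_block ** Slim ** transpose dist_block = 0"
      using flim[OF bounded_linear_congruence, of state_block "transpose dist_block"]
      by (simp add: avg[OF bounded_linear_congruence] unc LIMSEQ_const_iff)
    note dec = decouple_properties[OF psdI this]
    have "decouple Slim \<in> feasible_III d \<gamma> (second_moment P) A B"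
      unfolding feasible_III_iff using Ind distI nomI dynI[unfolded F_def] by (simp add: dec)
    moreover have "K ** decouple Slim ** transpose K = K ** Slim ** transpose K"
      unfolding K_def by (rule dec)
    ultimately show ?thesis using that[of "decouple Slim"] costlim unfolding K_def by simp
  qed
qed

section \<open>From covariance matrices to processes\<close>

lemma separable_metric_prob_space_borel:
  fixes M :: "'a::{metric_space, second_countable_topology} measure"
  assumes "prob_space M" "sets M = sets borel"
  shows "separable_metric_prob_space M"
proof -
  have sp: "space M = UNIV" using sets_eq_imp_space_eq[OF assms(2)] by simp
  obtain D :: "'a set" where D: "countable D" "\<And>X. open X \<Longrightarrow> X \<noteq> {} \<Longrightarrow> \<exists>d\<in>D. d \<in> X"
    using countable_dense_exists by blast
  have "closure D = UNIV"
    using D(2)[of "- closure D"] closure_subset[of D] by auto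
  then have "separable_space (euclidean :: 'a topology)"
    using D(1) by (auto simp: separable_space_def)
  then show ?thesis
    unfolding separable_metric_prob_space_def
    by (intro conjI exI[of _ euclidean_metric]) (simp_all add: assms sp borel_def)
qed

text \<open>Split the sum where the terms become \<open>e / 2\<close>-close to the limit; the head is a constant \<open>c\<close>,
  negligible after division by a large \<open>T\<close>.\<close>

lemma cesaro_limit:
  fixes f :: "nat \<Rightarrow> real"
  assumes "f \<longlonglongrightarrow> l"
  shows "(\<lambda>T. 1 / real T * (\<Sum>t<T. f t)) \<longlonglongrightarrow> l"
proof (rule LIMSEQ_I)
  fix e :: real assume e: "0 < e"
  obtain N where N: "\<And>n. n \<ge> N \<Longrightarrow> \<bar>f n - l\<bar> < e / 2"
    using LIMSEQ_D[OF assms, of "e / 2"] e by auto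
  define c where "c = (\<Sum>t<N. \<bar>f t - l\<bar>)"
  have "0 \<le> c" by (simp add: c_def sum_nonneg)
  obtain K :: nat where K: "2 * c / e < real K" using reals_Archimedean2 by blast
  show "\<exists>n0. \<forall>n\<ge>n0. norm (1 / real n * (\<Sum>t<n. f t) - l) < e"
  proof (intro exI allI impI)
    fix n assume n: "max (max K N) 1 \<le> n"
    then have n0: "0 < real n" and "real K \<le> real n" by auto
    then have "2 * c / e < real n" using K by linarith
    then have cn: "c < real n * (e / 2)" using e by (simp add: field_simps)
    have "1 / real n * (\<Sum>t<n. f t) - l = 1 / real n * (\<Sum>t<n. f t - l)"
      using n0 by (simp add: sum_subtractf field_simps)
    moreover have "\<bar>\<Sum>t<n. f t - l\<bar> < real n * e"
    proof -
      have "\<bar>\<Sum>t<n. f t - l\<bar> \<le> (\<Sum>t<n. \<bar>f t - l\<bar>)" by (rule sum_abs)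
      also have "\<dots> = c + (\<Sum>t\<in>{N..<n}. \<bar>f t - l\<bar>)"
        unfolding c_def using n by (subst sum.union_disjoint[symmetric]) (auto intro!: sum.cong)
      also have "(\<Sum>t\<in>{N..<n}. \<bar>f t - l\<bar>) \<le> (\<Sum>t\<in>{N..<n}. e / 2)"
        using N by (intro sum_mono) (auto intro: less_imp_le)
      also have "\<dots> \<le> real n * (e / 2)" using e by (auto intro!: mult_right_mono)
      finally show ?thesis using cn by simp
    qed
    ultimately show "norm (1 / real n * (\<Sum>t<n. f t) - l) < e"
      using n0 by (simp add: abs_mult field_simps)
  qed
qed

lemma average_cost_eq_limit:
  assumes "(\<lambda>t. \<integral>\<omega>. (norm (cl_output A B C D w t \<omega>))\<^sup>2 \<partial>M) \<longlonglongrightarrow> l"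
  shows "average_cost A B C D M w = ereal l"
  unfolding average_cost_def
  by (rule lim_imp_Limsup[OF _ tendsto_ereal[OF cesaro_limit[OF assms]]]) simp

primrec matrix_power :: "real^'n^'n \<Rightarrow> nat \<Rightarrow> real^'n^'n" where
  "matrix_power X 0 = mat 1"
| "matrix_power X (Suc t) = X ** matrix_power X t"

lemma matrix_power_mult_vec: "matrix_power X t *v v = ((*v) X ^^ t) v"
  by (induction t) (simp_all flip: matrix_vector_mul_assoc)

lemma stable_matrix_power_tendsto_0:
  assumes "stable_matrix A"
  shows "matrix_power A \<longlonglongrightarrow> 0"
proof (intro vec_tendstoI)
  fix i j
  have "(\<lambda>t. norm (((*v) A ^^ t) (axis j 1))) \<longlonglongrightarrow> 0"
    by (rule summable_LIMSEQ_zero[OF stable_matrix_summable_orbit[OF assms]])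
  then have "(\<lambda>t. (matrix_power A t *v axis j 1) $ i) \<longlonglongrightarrow> 0"
    unfolding matrix_power_mult_vec
    by (rule Lim_null_comparison[rotated]) (simp add: component_le_norm_cart)
  then show "(\<lambda>t. matrix_power A t $ i $ j) \<longlonglongrightarrow> 0 $ i $ j"
    by (simp add: matrix_vector_mult_basis column_def)
qed

lemma orthogonal_matrix_power:
  assumes "U ** transpose U = mat 1"
  shows "matrix_power U t ** transpose (matrix_power U t) = mat 1"
proof (induction t)
  case (Suc t)
  have "matrix_power U (Suc t) ** transpose (matrix_power U (Suc t))
      = U ** (matrix_power U t ** transpose (matrix_power U t)) ** transpose U"
    by (simp add: matrix_transpose_mul matrix_mul_assoc)
  then show ?case by (simp add: Suc.IH assms)
qed simp

text \<open>The norm on the right is the Frobenius norm, so costs under a Gaussian input become matrix norms.\<close>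

lemma integral_norm_sq_std_gaussian:
  "(\<integral>g. (norm (X *v g))\<^sup>2 \<partial>std_gaussian) = (norm (X :: real^'n^'m))\<^sup>2"
  by (simp add: integral_norm_sq_eq_trace[OF L2_matrix_vector_mult[OF std_gaussian_L2]]
      cross_moment_congruence[OF std_gaussian_L2] cross_moment_std_gaussian trace_congruence_eq_norm_sq)

text \<open>With \<open>R t = U\<^sup>t\<close> the vector \<open>L R(t) g\<close> is a stationary closed-loop trajectory. The true
  state starts at \<open>0\<close> and therefore lags behind by \<open>A\<^sup>t\<close> applied to the initial stationary
  state. The output is \<open>(K L R(t) - N(t)) g\<close> with \<open>N(t)\<close> tending to \<open>0\<close>, and the orthogonal
  \<open>R t\<close> does not change the Frobenius norm of \<open>K L\<close>.\<close>

lemma feasible_III_Cor_attained: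
  fixes A :: "real^'s^'s" and B :: "real^'w^'s" and C :: "real^'s^'z" and D :: "real^'w^'z"
    and P :: "(real^'w) measure"
  assumes A: "stable_matrix A" and P: "zero_mean_normal P"
    and S: "S \<in> feasible_III Cor \<gamma> (second_moment P) A B"
  defines "K \<equiv> C ** state_block + D ** dist_block"
  shows "ereal (trace (K ** S ** transpose K)) \<le> value_II Cor \<gamma> P A B C D"
proof -
  have psd: "psd S"
    and dyn: "state_block ** S ** transpose state_block
       = (A ** state_block + B ** dist_block) ** S ** transpose (A ** state_block + B ** dist_block)"
    and dist: "trace ((dist_block - nom_block) ** S ** transpose (dist_block - nom_block)) \<le> \<gamma>\<^sup>2"
    and nom: "nom_block ** S ** transpose nom_block = second_moment P"
    using S[unfolded feasible_III_iff] by blast+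
  define F where "F = A ** state_block + B ** (dist_block :: real^('s + ('w + 'w))^'w)"
  obtain L :: "real^('s + ('w + 'w))^('s + ('w + 'w))" where L: "S = L ** transpose L"
    using psd_eq_mult_transpose[OF psd] by blast
  have cong: "(X ** L) ** transpose (X ** L) = X ** S ** transpose X"
    for X :: "real^('s + ('w + 'w))^'m"
    by (simp add: L matrix_transpose_mul matrix_mul_assoc)
  have "(state_block ** L) ** transpose (state_block ** L) = (F ** L) ** transpose (F ** L)"
    unfolding cong F_def by (rule dyn)
  then obtain U where U: "U ** transpose U = mat 1" "(state_block ** L) ** U = F ** L"
    using ex_orthogonal_matrix_equal_Gram by blast
  define R where "R = matrix_power U"
  have R: "R t ** transpose (R t) = mat 1" for t unfolding R_def
    by (rule orthogonal_matrix_power[OF U(1)])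
  have congR: "(X ** R t) ** transpose (X ** R t) = X ** transpose X"
    for X :: "real^('s + ('w + 'w))^'m" and t
  proof -
    have "(X ** R t) ** transpose (X ** R t) = X ** (R t ** transpose (R t)) ** transpose X"
      by (simp add: matrix_transpose_mul matrix_mul_assoc)
    then show ?thesis by (simp add: R)
  qed
  let ?M = "std_gaussian :: (real^('s + ('w + 'w))) measure"
  define w where "w t g = (dist_block ** L ** R t) *v g" for t and g :: "real^('s + ('w + 'w))"
  define w' where "w' t g = (nom_block ** L ** R t) *v g" for t and g :: "real^('s + ('w + 'w))"
  \<comment> \<open>This is where stationarity enters: one more factor \<open>U\<close> turns the state rows into \<open>F L\<close>.\<close>
  have step: "F ** L ** R t = state_block ** L ** R (Suc t)" for t
    by (simp add: R_def U(2)[symmetric] matrix_mul_assoc)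
  have state: "cl_state A B w t g = (state_block ** L ** R t - matrix_power A t ** (state_block ** L)) *v g" for t g
  proof (induction t)
    case 0
    show ?case by (simp add: R_def)
  next
    case (Suc t)
    have "cl_state A B w (Suc t) g
        = (A ** (state_block ** L ** R t - matrix_power A t ** (state_block ** L)) + B ** (dist_block ** L ** R t)) *v g"
      by (simp add: Suc.IH w_def matrix_vector_mult_add_rdistrib flip: matrix_vector_mul_assoc)
    also have "A ** (state_block ** L ** R t - matrix_power A t ** (state_block ** L)) + B ** (dist_block ** L ** R t)
        = F ** L ** R t - matrix_power A (Suc t) ** (state_block ** L)"
      by (simp add: F_def matrix_mult.diff_right matrix_mult.add_left matrix_mul_assoc)
    finally show ?case by (simp only: step)
  qed
  define N where "N t = C ** matrix_power A t ** (state_block ** L)" for t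
  have out: "cl_output A B C D w t g = (K ** L ** R t - N t) *v g" for t g
    by (simp add: cl_output_def state w_def K_def N_def matrix_vector_mult_add_rdistrib matrix_vector_mult_diff_rdistrib
        matrix_vector_mult_diff_distrib matrix_mult.add_left matrix_mul_assoc matrix_vector_mul_assoc)
  have cost: "(\<lambda>t. \<integral>g. (norm (cl_output A B C D w t g))\<^sup>2 \<partial>?M) \<longlonglongrightarrow> trace (K ** S ** transpose K)"
  proof -
    have "N \<longlonglongrightarrow> C ** 0 ** (state_block ** L)"
      unfolding N_def[abs_def]
      by (intro matrix_mult.tendsto tendsto_const stable_matrix_power_tendsto_0 A)
    then have N0: "N \<longlonglongrightarrow> 0" by (simp add: matrix_mult.zero_left matrix_mult.zero_right)
    have norm_KLR: "norm (K ** L ** R t) = norm (K ** L)" for t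
    proof -
      have "(norm (K ** L ** R t))\<^sup>2 = (norm (K ** L))\<^sup>2"
        unfolding trace_congruence_eq_norm_sq[symmetric] congR ..
      then show ?thesis by (simp add: power2_eq_iff_nonneg)
    qed
    have "(\<lambda>t. norm (K ** L ** R t - N t) - norm (K ** L)) \<longlonglongrightarrow> 0"
    proof (rule Lim_null_comparison)
      show "\<forall>\<^sub>F t in sequentially. norm (norm (K ** L ** R t - N t) - norm (K ** L)) \<le> norm (N t)"
      proof (rule always_eventually, rule allI)
        show "norm (norm (K ** L ** R t - N t) - norm (K ** L)) \<le> norm (N t)" for t
          using norm_triangle_ineq3[of "K ** L ** R t - N t" "K ** L ** R t"]
            by (simp add: norm_KLR)
      qed
      show "(\<lambda>t. norm (N t)) \<longlonglongrightarrow> 0" using tendsto_norm[OF N0] by simp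
    qed
    then have "(\<lambda>t. norm (K ** L ** R t - N t)) \<longlonglongrightarrow> norm (K ** L)" by (rule LIM_zero_cancel)
    then have "(\<lambda>t. (norm (K ** L ** R t - N t))\<^sup>2) \<longlonglongrightarrow> (norm (K ** L))\<^sup>2" by (rule tendsto_power)
    then show ?thesis
      by (simp add: out integral_norm_sq_std_gaussian cong flip: trace_congruence_eq_norm_sq)
  qed
  have "feasible_II Cor \<gamma> P ?M w w'"
    unfolding feasible_II_def
  proof (intro conjI allI impI)
    fix t
    show "w t \<in> L2 ?M" "w' t \<in> L2 ?M"
      using L2_matrix_vector_mult[OF std_gaussian_L2, of "dist_block ** L ** R t"]
        L2_matrix_vector_mult[OF std_gaussian_L2, of "nom_block ** L ** R t"]
      by (simp_all add: w_def[abs_def] w'_def[abs_def])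
    have "w t g - w' t g = ((dist_block - nom_block) ** L ** R t) *v g" for g
      by (simp add: w_def w'_def matrix_mult.diff_left matrix_vector_mult_diff_rdistrib)
    then have "(\<integral>g. (norm (w t g - w' t g))\<^sup>2 \<partial>?M) = (norm ((dist_block - nom_block) ** L ** R t))\<^sup>2"
      by (simp add: integral_norm_sq_std_gaussian)
    also have "\<dots> \<le> \<gamma>\<^sup>2"
      unfolding trace_congruence_eq_norm_sq[symmetric] congR cong by (rule dist)
    finally show "(\<integral>g. (norm (w t g - w' t g))\<^sup>2 \<partial>?M) \<le> \<gamma>\<^sup>2" .
    have "(nom_block ** L ** R t) ** transpose (nom_block ** L ** R t) = second_moment P"
      unfolding congR cong by (rule nom)
    then show "distr ?M borel (w' t) = P"
      unfolding w'_def[abs_def] by (rule distr_std_gaussian_eq[OF P])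
  qed simp_all
  moreover have "separable_metric_prob_space ?M"
    by (rule separable_metric_prob_space_borel) (simp_all add: prob_space_std_gaussian)
  ultimately have "average_cost A B C D ?M w \<le> value_II Cor \<gamma> P A B C D"
    by (intro average_cost_le_value_II)
  then show ?thesis by (simp add: average_cost_eq_limit[OF cost])
qed

text \<open>Coordinates of an infinite product. The sequence space is a separable metric space whose Borel sets
  are the product sigma-algebra, so it qualifies as a probability space of Problem (II).\<close>

lemma iid_sequence:
  fixes N :: "(real^'n) measure"
  assumes N: "prob_space N" "sets N = sets borel"
  defines "M \<equiv> \<Pi>\<^sub>M t\<in>(UNIV :: nat set). N"
  shows "prob_space M" "separable_metric_prob_space M"
    "\<And>t. (\<lambda>\<omega>. \<omega> t) \<in> measurable M N" "\<And>t. distr M N (\<lambda>\<omega>. \<omega> t) = N"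
    "\<And>f :: real^'n \<Rightarrow> real^'m. f \<in> borel_measurable borel \<Longrightarrow>
       prob_space.indep_vars M (\<lambda>_. borel) (\<lambda>t \<omega>. f (\<omega> t)) UNIV"
proof -
  show M: "prob_space M" unfolding M_def by (intro prob_space_PiM N)
  show coord: "(\<lambda>\<omega>. \<omega> t) \<in> measurable M N" for t unfolding M_def by measurable
  show dist: "distr M N (\<lambda>\<omega>. \<omega> t) = N" for t
    unfolding M_def by (rule distr_PiM_component) (auto simp: N)
  have "sets M = sets (\<Pi>\<^sub>M t\<in>(UNIV :: nat set). (borel :: (real^'n) measure))"
    unfolding M_def by (rule sets_PiM_cong) (auto simp: N)
  then show "separable_metric_prob_space M"
    using M by (intro separable_metric_prob_space_borel) (simp_all add: sets_PiM_equal_borel)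
  interpret prob_space M by fact
  have "distr M (\<Pi>\<^sub>M t\<in>(UNIV :: nat set). N) (\<lambda>\<omega>. \<lambda>t\<in>UNIV. \<omega> t) = M"
    using distr_id[of M] by (simp add: M_def restrict_def)
  then have "indep_vars (\<lambda>_. N) (\<lambda>t \<omega>. \<omega> t) UNIV"
    using coord by (subst indep_vars_iff_distr_eq_PiM) (simp_all add: dist M_def[symmetric])
  then show "indep_vars (\<lambda>_. borel) (\<lambda>t \<omega>. f (\<omega> t)) UNIV"
    if "f \<in> borel_measurable borel" for f :: "real^'n \<Rightarrow> real^'m"
    by (rule indep_vars_compose2) (use that N in \<open>simp add: measurable_cong_sets[OF N(2) refl]\<close>)
qed

lemma L2_compose:
  assumes h: "h \<in> measurable M N" and N: "distr M N h = N" and f: "f \<in> L2 N"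
  shows "(\<lambda>\<omega>. f (h \<omega>)) \<in> L2 M"
  using f measurable_compose[OF h] integrable_distr[OF h, of "\<lambda>x. (norm (f x))\<^sup>2"] N
  by (auto simp: L2_def)

text \<open>The supply of candidates for the independent case: disturbance and nominal disturbance are two
  linear images of one independent, identically distributed sequence.\<close>

lemma feasible_II_iid:
  fixes P :: "(real^'w) measure" and N :: "(real^'n) measure" and X Y :: "real^'n^'w"
  assumes N: "prob_space N" "sets N = sets borel" "(\<lambda>x. x) \<in> L2 N" "(\<integral>x. x \<partial>N) = 0"
    and dist: "trace ((X - Y) ** cross_moment N (\<lambda>x. x) (\<lambda>x. x) ** transpose (X - Y)) \<le> \<gamma>\<^sup>2"
    and law: "distr N borel ((*v) Y) = P"
  shows "feasible_II d \<gamma> P (\<Pi>\<^sub>M t\<in>(UNIV :: nat set). N) (\<lambda>t \<omega>. X *v \<omega> t) (\<lambda>t \<omega>. Y *v \<omega> t)"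
proof -
  let ?M = "\<Pi>\<^sub>M t\<in>(UNIV :: nat set). N"
  note iid = iid_sequence[OF N(1,2)]
  interpret M: prob_space ?M by (rule iid(1))
  interpret N: prob_space N by (rule N(1))
  have mN: "f \<in> borel_measurable N" if "f \<in> borel_measurable borel"
    for f :: "real^'n \<Rightarrow> 'b::topological_space"
    using that by (simp add: measurable_cong_sets[OF N(2) refl])
  have L2: "(\<lambda>\<omega>. Z *v \<omega> t) \<in> L2 ?M" for Z :: "real^'n^'w" and t
    by (rule L2_compose[OF iid(3,4) L2_matrix_vector_mult[OF N(3)]])
  have int: "(\<integral>\<omega>. f (\<omega> t) \<partial>?M) = (\<integral>x. f x \<partial>N)" if "f \<in> borel_measurable borel"
    for f :: "real^'n \<Rightarrow> 'b::{banach, second_countable_topology}" and t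
    using integral_distr[OF iid(3) mN[OF that], of t] by (simp add: iid(4))
  show ?thesis
    unfolding feasible_II_def
  proof (intro conjI allI impI L2)
    fix t
    have "(\<integral>\<omega>. (norm (X *v \<omega> t - Y *v \<omega> t))\<^sup>2 \<partial>?M) = (\<integral>x. (norm ((X - Y) *v x))\<^sup>2 \<partial>N)"
      by (subst int) (simp_all add: matrix_vector_mult_diff_rdistrib)
    also have "\<dots> \<le> \<gamma>\<^sup>2"
      using dist
        by (simp add: integral_norm_sq_eq_trace[OF L2_matrix_vector_mult[OF N(3)]] cross_moment_congruence[OF N(3)])
    finally show "(\<integral>\<omega>. (norm (X *v \<omega> t - Y *v \<omega> t))\<^sup>2 \<partial>?M) \<le> \<gamma>\<^sup>2" .
    have "distr ?M borel (\<lambda>\<omega>. Y *v \<omega> t) = distr (distr ?M N (\<lambda>\<omega>. \<omega> t)) borel ((*v) Y)"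
      by (subst distr_distr[OF mN iid(3)]) (simp_all add: comp_def)
    then show "distr ?M borel (\<lambda>\<omega>. Y *v \<omega> t) = P" by (simp add: iid(4) law)
    have "(\<integral>\<omega>. X *v \<omega> t \<partial>?M) = (\<integral>x. X *v x \<partial>N)" by (subst int) simp_all
    also have "\<dots> = X *v (\<integral>x. x \<partial>N)"
      by (rule integral_bounded_linear[OF matrix_vector_mul_bounded_linear N.L2_imp_integrable[OF N(3)]])
    finally show "(\<integral>\<omega>. X *v \<omega> t \<partial>?M) = 0" by (simp add: N(4))
  next
    show "M.indep_vars (\<lambda>_. borel) (\<lambda>t \<omega>. X *v \<omega> t) UNIV" by (rule iid(5)) simp
  qed
qed

text \<open>The state covariances \<open>X t\<close> and the state block \<open>Sx\<close> of \<open>S\<close> obey the same recursion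
  \<open>X \<mapsto> A X A\<^sup>T + B Q B\<^sup>T\<close>, where \<open>Sx\<close> is the fixed point. Their difference is \<open>A\<^sup>t Sx (A\<^sup>t)\<^sup>T\<close> and
  tends to \<open>0\<close>.\<close>

lemma feasible_III_Ind_attained:
  fixes A :: "real^'s^'s" and B :: "real^'w^'s" and C :: "real^'s^'z" and D :: "real^'w^'z"
    and P :: "(real^'w) measure"
  assumes A: "stable_matrix A" and P: "zero_mean_normal P"
    and S: "S \<in> feasible_III Ind \<gamma> (second_moment P) A B"
  defines "K \<equiv> C ** state_block + D ** dist_block"
  shows "ereal (trace (K ** S ** transpose K)) \<le> value_II Ind \<gamma> P A B C D"
proof -
  have psd: "psd S" and cov: "S \<in> covariance_class Ind"
    and dyn: "state_block ** S ** transpose state_block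
       = (A ** state_block + B ** dist_block) ** S ** transpose (A ** state_block + B ** dist_block)"
    and dist: "trace ((dist_block - nom_block) ** S ** transpose (dist_block - nom_block)) \<le> \<gamma>\<^sup>2"
    and nom: "nom_block ** S ** transpose nom_block = second_moment P"
    using S[unfolded feasible_III_iff] by blast+
  have sym: "transpose S = S" and unc: "state_block ** S ** transpose dist_block = 0"
    using cov unfolding covariance_class_Ind_iff symmetric_matrix_def by auto
  obtain L :: "real^('s + ('w + 'w))^('s + ('w + 'w))" where L: "S = L ** transpose L"
    using psd_eq_mult_transpose[OF psd] by blast
  have cong: "(X ** L) ** transpose (X ** L) = X ** S ** transpose X"
    for X :: "real^('s + ('w + 'w))^'m"
    by (simp add: L matrix_transpose_mul matrix_mul_assoc)
  let ?N = "std_gaussian :: (real^('s + ('w + 'w))) measure"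
  let ?M = "\<Pi>\<^sub>M t\<in>(UNIV :: nat set). ?N"
  note iid = iid_sequence[OF prob_space_std_gaussian sets_std_gaussian]
  interpret M: prob_space ?M by (rule iid(1))
  define w where "w t \<omega> = (dist_block ** L) *v \<omega> t"
    for t :: nat and \<omega> :: "nat \<Rightarrow> real^('s + ('w + 'w))"
  define w' where "w' t \<omega> = (nom_block ** L) *v \<omega> t"
    for t :: nat and \<omega> :: "nat \<Rightarrow> real^('s + ('w + 'w))"
  have feas: "feasible_II Ind \<gamma> P ?M w w'"
    unfolding w_def[abs_def] w'_def[abs_def]
  proof (rule feasible_II_iid)
    have "dist_block ** L - nom_block ** L = (dist_block - nom_block) ** L"
      by (simp add: matrix_mult.diff_left)
    then show "trace ((dist_block ** L - nom_block ** L) ** cross_moment ?N (\<lambda>x. x) (\<lambda>x. x)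
        ** transpose (dist_block ** L - nom_block ** L)) \<le> \<gamma>\<^sup>2"
      using dist by (simp add: cross_moment_std_gaussian cong)
    show "distr ?N borel ((*v) (nom_block ** L)) = P"
      by (rule distr_std_gaussian_eq[OF P]) (simp add: cong nom)
  qed (simp_all add: prob_space_std_gaussian std_gaussian_L2 integral_std_gaussian)
  have w: "w t \<in> L2 ?M" for t using feas by (simp add: feasible_II_def)
  define x where "x = cl_state A B w"
  have x: "x t \<in> L2 ?M" for t unfolding x_def by (rule L2_cl_state) (rule w)
  have xw: "cross_moment ?M (x t) (w t) = 0" for t
    unfolding x_def using feas by (intro M.cl_state_uncorrelated w) (auto simp: feasible_II_def)
  define Q where "Q = dist_block ** S ** transpose dist_block"
  have ww: "cross_moment ?M (w t) (w t) = Q" for t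
  proof -
    have "cross_moment ?M (w t) (w t) = cross_moment (distr ?M ?N (\<lambda>\<omega>. \<omega> t)) (\<lambda>x. (dist_block ** L) *v x) (\<lambda>x. (dist_block ** L) *v x)"
      unfolding w_def[abs_def] by (subst cross_moment_distr[OF iid(3)]) simp_all
    also have "\<dots> = Q"
      by (simp add: iid(4) cross_moment_congruence[OF std_gaussian_L2] cross_moment_std_gaussian cong Q_def)
    finally show ?thesis .
  qed
  define X where "X t = cross_moment ?M (x t) (x t)" for t
  define Sx where "Sx = state_block ** S ** transpose state_block"
  have Sx: "Sx = A ** Sx ** transpose A + B ** Q ** transpose B"
    unfolding Sx_def Q_def by (subst dyn) (rule congruence_sum_uncorrelated[OF sym unc])
  have X_Suc: "X (Suc t) = A ** X t ** transpose A + B ** Q ** transpose B" for t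
    using cross_moment_sum_uncorrelated[OF x[of t] w[of t] xw[of t], of A B]
    by (simp add: X_def x_def ww)
  have X_eq: "X t = Sx - matrix_power A t ** Sx ** transpose (matrix_power A t)" for t
  proof (induction t)
    case 0
    show ?case by (simp add: X_def x_def cross_moment_def vec_eq_iff)
  next
    case (Suc t)
    have "X (Suc t) = (A ** Sx ** transpose A + B ** Q ** transpose B)
        - A ** (matrix_power A t ** Sx ** transpose (matrix_power A t)) ** transpose A"
      by (simp add: X_Suc Suc.IH matrix_mult.diff_left matrix_mult.diff_right)
    then show ?case by (simp add: Sx[symmetric] matrix_transpose_mul matrix_mul_assoc)
  qed
  have "X \<longlonglongrightarrow> Sx - 0 ** Sx ** transpose 0"
    unfolding X_eq[abs_def]
    by (intro tendsto_diff tendsto_const matrix_mult.tendsto stable_matrix_power_tendsto_0[OF A]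
        bounded_linear.tendsto[OF bounded_linear_transpose])
  then have Xlim: "X \<longlonglongrightarrow> Sx" by (simp add: matrix_mult.zero_left)
  have cost: "(\<integral>\<omega>. (norm (cl_output A B C D w t \<omega>))\<^sup>2 \<partial>?M) = trace (C ** X t ** transpose C + D ** Q ** transpose D)" for t
  proof -
    have "cl_output A B C D w t = (\<lambda>\<omega>. C *v x t \<omega> + D *v w t \<omega>)"
      by (simp add: cl_output_def x_def)
    moreover have "(\<lambda>\<omega>. C *v x t \<omega> + D *v w t \<omega>) \<in> L2 ?M"
      by (intro L2_add L2_matrix_vector_mult x w)
    ultimately show ?thesis
      by (simp add: integral_norm_sq_eq_trace cross_moment_sum_uncorrelated[OF x w xw] X_def ww)
  qed
  have "(\<lambda>t. trace (C ** X t ** transpose C + D ** Q ** transpose D))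
      \<longlonglongrightarrow> trace (C ** Sx ** transpose C + D ** Q ** transpose D)"
    by (intro bounded_linear.tendsto[OF bounded_linear_trace] tendsto_add tendsto_const
        bounded_linear.tendsto[OF bounded_linear_congruence] Xlim)
  then have "(\<lambda>t. \<integral>\<omega>. (norm (cl_output A B C D w t \<omega>))\<^sup>2 \<partial>?M) \<longlonglongrightarrow> trace (K ** S ** transpose K)"
    unfolding K_def cost congruence_sum_uncorrelated[OF sym unc] Sx_def Q_def .
  from average_cost_eq_limit[OF this] average_cost_le_value_II[OF iid(2) feas, of A B C D]
  show ?thesis by simp
qed

text \<open>Independent nominal disturbances, left unperturbed, are admissible in both cases. This gives
  feasibility of Problem (II), and through the limit argument that of Problem (III).\<close>

lemma ex_feasible_II:
  fixes P :: "(real^'w) measure"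
  assumes P: "zero_mean_normal P"
  shows "feasible_II d \<gamma> P (\<Pi>\<^sub>M t\<in>(UNIV :: nat set). P) (\<lambda>t \<omega>. \<omega> t) (\<lambda>t \<omega>. \<omega> t)"
proof -
  have "(\<integral>x. x \<partial>P) = 0"
  proof -
    have "prob_space P" using P by (simp add: zero_mean_normal_def)
    then have "integrable P (\<lambda>x. x)"
      by (rule prob_space.L2_imp_integrable[OF _ zero_mean_normal_L2[OF P]])
    then have "v \<bullet> (\<integral>x. x \<partial>P) = 0" for v
      using zero_mean_normal_marginal(2)[OF P, of v] by (simp add: integral_inner_right)
    then show ?thesis using inner_eq_zero_iff by blast
  qed
  moreover have "distr P borel ((*v) (mat 1)) = P"
  proof -
    have "distr P borel (\<lambda>x. x) = P" using P by (intro distr_id2) (simp add: zero_mean_normal_def)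
    then show ?thesis by (simp add: fun_eq_iff cong: distr_cong)
  qed
  ultimately have "feasible_II d \<gamma> P (\<Pi>\<^sub>M t\<in>(UNIV :: nat set). P) (\<lambda>t \<omega>. mat 1 *v \<omega> t) (\<lambda>t \<omega>. mat 1 *v \<omega> t)"
    using P by (intro feasible_II_iid zero_mean_normal_L2)
      (auto simp: zero_mean_normal_def matrix_mult.zero_left bounded_linear.linear[OF bounded_linear_trace, THEN linear_0])
  then show ?thesis by simp
qed

text \<open>A finite cost bounds the supremum of Problem (II) from below, so its candidate set,
  whose probability spaces live on a fixed type, is not empty.\<close>

theorem values_coincide:
  fixes A :: "real^'s^'s" and B :: "real^'w^'s" and C :: "real^'s^'z" and D :: "real^'w^'z"
    and P :: "(real^'w) measure"
  assumes A: "stable_matrix A" and P: "zero_mean_normal P"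
  shows "candidates_II d \<gamma> P \<noteq> {}" "feasible_III d \<gamma> (second_moment P) A B \<noteq> {}"
    "value_II d \<gamma> P A B C D = value_III d \<gamma> (second_moment P) A B C D"
proof -
  have NP: "prob_space P" "sets P = sets borel" using P by (auto simp: zero_mean_normal_def)
  note iid = iid_sequence[OF NP]
  obtain S where S: "S \<in> feasible_III d \<gamma> (second_moment P) A B"
    and cost: "average_cost A B C D (\<Pi>\<^sub>M t\<in>(UNIV :: nat set). P) (\<lambda>t \<omega>. \<omega> t)
      = ereal (trace ((C ** state_block + D ** dist_block) ** S ** transpose (C ** state_block + D ** dist_block)))"
    using average_cost_attained_by_covariance[OF A P iid(1) ex_feasible_II[OF P], where C = C and D = D and B = B] by blast
  show "feasible_III d \<gamma> (second_moment P) A B \<noteq> {}" using S by blast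
  show "candidates_II d \<gamma> P \<noteq> {}"
  proof
    assume "candidates_II d \<gamma> P = {}"
    then have "value_II d \<gamma> P A B C D = - \<infinity>" by (simp add: value_II_def bot_ereal_def)
    then show False
      using average_cost_le_value_II[OF iid(2) ex_feasible_II[OF P], of A B C D d \<gamma>]
        by (simp add: cost)
  qed
  show "value_II d \<gamma> P A B C D = value_III d \<gamma> (second_moment P) A B C D"
  proof (rule antisym)
    show "value_II d \<gamma> P A B C D \<le> value_III d \<gamma> (second_moment P) A B C D"
      unfolding value_II_def
    proof (rule SUP_least, clarify)
      fix M :: "(nat \<Rightarrow> real) measure" and w w' :: "nat \<Rightarrow> (nat \<Rightarrow> real) \<Rightarrow> real^'w"
      assume "(M, w, w') \<in> candidates_II d \<gamma> P"
      then have M: "prob_space M" and feas: "feasible_II d \<gamma> P M w w'"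
        by (auto simp: candidates_II_def separable_metric_prob_space_def)
      obtain T where "T \<in> feasible_III d \<gamma> (second_moment P) A B"
        "average_cost A B C D M w
          = ereal (trace ((C ** state_block + D ** dist_block) ** T ** transpose (C ** state_block + D ** dist_block)))"
        using average_cost_attained_by_covariance[OF A P M feas, where C = C and D = D and B = B]
          by blast
      then show "average_cost A B C D M w \<le> value_III d \<gamma> (second_moment P) A B C D"
        unfolding value_III_def by (intro SUP_upper2[of T]) (simp_all add: hcat_eq_blocks Let_def)
    qed
    show "value_III d \<gamma> (second_moment P) A B C D \<le> value_II d \<gamma> P A B C D"
      unfolding value_III_def Let_def hcat_eq_blocks
      using feasible_III_Cor_attained[OF A P] feasible_III_Ind_attained[OF A P]
      by (cases d) (auto intro!: SUP_least)
  qed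
qed

theorem theorem3:
  fixes A :: "real^'x^'x" and Bw :: "real^'w^'x" and Bu :: "real^'u^'x"
    and Cz :: "real^'x^'z" and Dzw :: "real^'w^'z" and Dzu :: "real^'u^'z"
    and Cy :: "real^'x^'y" and Dyw :: "real^'w^'y"
    and Ac :: "real^'x^'x" and Bc :: "real^'y^'x" and Cc :: "real^'x^'u" and Dc :: "real^'y^'u"
    and \<A> :: "real^('x + 'x)^('x + 'x)" and \<B> :: "real^'w^('x + 'x)"
    and \<C> :: "real^('x + 'x)^'z" and \<D> :: "real^'w^'z"
    and \<gamma> :: real and Pnom :: "(real^'w) measure" and Snom :: "real^'w^'w"
    and d :: disturbance_class
  assumes "\<A> = vcat (hcat (A + Bu ** Dc ** Cy) (Bu ** Cc)) (hcat (Bc ** Cy) Ac)"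
    and "\<B> = vcat (Bw + Bu ** Dc ** Dyw) (Bc ** Dyw)"
    and "\<C> = hcat (Cz + Dzu ** Dc ** Cy) (Dzu ** Cc)"
    and "\<D> = Dzw + Dzu ** Dc ** Dyw"
    and "stable_matrix \<A>"
    and "0 \<le> \<gamma>"
    and "zero_mean_normal Pnom"
    and "Snom = second_moment Pnom"
  shows "candidates_II d \<gamma> Pnom \<noteq> {} \<and>
    feasible_III d \<gamma> Snom \<A> \<B> \<noteq> {} \<and>
    value_II d \<gamma> Pnom \<A> \<B> \<C> \<D> = value_III d \<gamma> Snom \<A> \<B> \<C> \<D>"
  unfolding assms(8) by (intro conjI values_coincide[OF assms(5,7)])

end
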